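(* Let $\psi_1,\psi_2\in L^2(\mathbb R)$ satisfy: (i) $\int_0^\infty|\hat\psi_1(a\xi)|^2\,\frac{da}{a}=1$ for a.e. $\xi\in\mathbb R$; (ii) $\|\psi_2\|_{L^2}=1$. Suppose $\psi\in L^2(\mathbb R^2)$ is given by $\hat\psi(\xi_1,\xi_2)=\hat\psi_1(\xi_1)\,\hat\psi_2\big(\tfrac{\xi_2}{\xi_1}\big)$ for $\xi_1\ne0$. For $a>0$, $s\in\mathbb R$, $t\in\mathbb R^2$ let $$M_{as}=\begin{pmatrix}a&-\sqrt a\,s\\0&\sqrt a\end{pmatrix},\qquad \psi_{ast}(x)=|\det M_{as}|^{-1/2}\,\psi\big(M_{as}^{-1}(x-t)\big).$$ Then $\psi$ is a continuous wavelet for $L^2(\mathbb R^2)$ with respect to $\Lambda=\{(M_{as},t):a>0,\ s\in\mathbb R,\ t\in\mathbb R^2\}$; that is, for all $f\in L^2(\mathbb R^2)$, $$f=\int_{\mathbb R^2}\int_{-\infty}^{\infty}\int_0^\infty\langle f,\psi_{ast}\rangle\,\psi_{ast}\,\frac{da}{a^3}\,ds\,dt .$$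
   Context: Fourier transform: $\hat g(\xi)=\int g(x)e^{-2\pi i\xi\cdot x}\,dx$. The reproducing formula is understood in the weak sense: $\langle f,g\rangle=\int\int\int\langle f,\psi_{ast}\rangle\langle\psi_{ast},g\rangle\,\frac{da}{a^3}\,ds\,dt$ for all $g\in L^2(\mathbb R^2)$. In general, for a set $G\subset GL_n(\mathbb R)$ with a measure $\lambda$, a function $\psi$ is called a continuous wavelet with respect to $\{(M,t):M\in G,\,t\in\mathbb R^n\}$ if $f=\int_{\mathbb R^n}\int_G\langle f,T_tD_M\psi\rangle\,T_tD_M\psi\,d\lambda(M)\,dt$ for all $f\in L^2(\mathbb R^n)$, where $T_tg(x)=g(x-t)$ and $D_Mg(x)=|\det M|^{-1/2}g(M^{-1}x)$. Here the measure on $\{M_{as}\}$ is $d\lambda(M_{as})=\frac{da}{|\det M_{as}|^2}\,ds=\frac{da}{a^3}\,ds$. *)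

theory Defs
  imports "HOL-Analysis.Analysis"
begin

text \<open>Elements of \<open>L\<^sup>2\<close> are represented by Lebesgue measurable, square integrable functions
  rather than by equivalence classes; all notions below are invariant under changes on null sets.\<close>

definition L2 :: "('a::euclidean_space \<Rightarrow> complex) set" where
  "L2 = {f. f \<in> borel_measurable lebesgue \<and> integrable lebesgue (\<lambda>x. (cmod (f x))\<^sup>2)}"

definition L2_norm :: "('a::euclidean_space \<Rightarrow> complex) \<Rightarrow> real" where
  "L2_norm f = sqrt (LINT x|lebesgue. (cmod (f x))\<^sup>2)"

definition L2_inner :: "('a::euclidean_space \<Rightarrow> complex) \<Rightarrow> ('a \<Rightarrow> complex) \<Rightarrow> complex" where
  "L2_inner f g = (LINT x|lebesgue. f x * cnj (g x))"

definition L2_tendsto ::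
  "(nat \<Rightarrow> 'a::euclidean_space \<Rightarrow> complex) \<Rightarrow> ('a \<Rightarrow> complex) \<Rightarrow> bool" where
  "L2_tendsto h f \<longleftrightarrow>
     (\<forall>n. h n \<in> L2) \<and> f \<in> L2 \<and> (\<lambda>n. L2_norm (\<lambda>x. h n x - f x)) \<longlonglongrightarrow> 0"

definition fourier :: "('a::euclidean_space \<Rightarrow> complex) \<Rightarrow> 'a \<Rightarrow> complex" where
  "fourier g \<xi> = (LINT x|lebesgue. g x * cis (- (2 * pi * (\<xi> \<bullet> x))))"

text \<open>The integral \<^const>\<open>fourier\<close> converges only for integrable functions. On \<open>L\<^sup>2\<close> the Fourier
  transform is its continuous extension from \<open>L\<^sup>1 \<inter> L\<^sup>2\<close> (Plancherel):
  \<open>has_L2_fourier f F\<close> says that \<open>F\<close> is a representative of the \<open>L\<^sup>2\<close> Fourier transform of \<open>f\<close>.\<close>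

definition has_L2_fourier ::
  "('a::euclidean_space \<Rightarrow> complex) \<Rightarrow> ('a \<Rightarrow> complex) \<Rightarrow> bool" where
  "has_L2_fourier f F \<longleftrightarrow>
     (\<exists>h. (\<forall>n. integrable lebesgue (h n)) \<and> L2_tendsto h f \<and> L2_tendsto (\<lambda>n. fourier (h n)) F)"

definition translate :: "real^'n \<Rightarrow> (real^'n \<Rightarrow> complex) \<Rightarrow> real^'n \<Rightarrow> complex" where
  "translate t g x = g (x - t)"

definition dilate :: "real^'n^'n \<Rightarrow> (real^'n \<Rightarrow> complex) \<Rightarrow> real^'n \<Rightarrow> complex" where
  "dilate M g x = complex_of_real (\<bar>det M\<bar> powr (- 1 / 2)) * g (matrix_inv M *v x)"

text \<open>The reproducing formula is read weakly, i.e. after pairing with an arbitrary \<open>g\<close> in \<open>L\<^sup>2\<close>.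
  Absolute convergence of the resulting scalar integral is demanded explicitly, because the
  Bochner integral of a non-integrable function is 0 by convention.\<close>

definition continuous_wavelet ::
  "(real^'n^'n) set \<Rightarrow> (real^'n^'n) measure \<Rightarrow> (real^'n \<Rightarrow> complex) \<Rightarrow> bool" where
  "continuous_wavelet G \<mu> \<psi> \<longleftrightarrow>
     G \<subseteq> {M. invertible M} \<and> \<psi> \<in> L2 \<and>
     (\<forall>f\<in>L2. \<forall>g\<in>L2.
        set_integrable (lborel \<Otimes>\<^sub>M \<mu>) (UNIV \<times> G)
          (\<lambda>(t, M). L2_inner f (translate t (dilate M \<psi>)) *
                    L2_inner (translate t (dilate M \<psi>)) g) \<and>
        L2_inner f g =
          (LINT t|lborel. (LINT M:G|\<mu>.
             L2_inner f (translate t (dilate M \<psi>)) * L2_inner (translate t (dilate M \<psi>)) g)))"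

definition shear_mat :: "real \<Rightarrow> real \<Rightarrow> real^2^2" where
  "shear_mat a s = vector [vector [a, - sqrt a * s], vector [0, sqrt a]]"

definition shear_set :: "(real^2^2) set" where
  "shear_set = {shear_mat a s | a s. a > 0}"

text \<open>The image of \<open>da / a\<^sup>3 ds\<close> on \<open>(0, \<infinity>) \<times> \<real>\<close> under \<^const>\<open>shear_mat\<close>.\<close>

definition shear_measure :: "(real^2^2) measure" where
  "shear_measure =
     distr (density (lborel \<Otimes>\<^sub>M lborel) (\<lambda>(a, s). ennreal (indicator {0<..} a / a ^ 3)))
       borel (\<lambda>(a, s). shear_mat a s)"

definition shearlet :: "(real^2 \<Rightarrow> complex) \<Rightarrow> real \<Rightarrow> real \<Rightarrow> real^2 \<Rightarrow> real^2 \<Rightarrow> complex" where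
  "shearlet \<psi> a s t = translate t (dilate (shear_mat a s) \<psi>)"

end

theory Submission
  imports Defs "HOL-Probability.Characteristic_Functions"
begin

text \<open>For fixed \<open>(a, s)\<close> the coefficient \<open>\<langle>f, \<psi>\<^sub>a\<^sub>s\<^sub>t\<rangle>\<close> is, as a function of \<open>t\<close>, a correlation, so
  Plancherel turns its square integral over \<open>t\<close> into
  \<open>\<integral> \<bar>f^(\<xi>)\<bar>\<^sup>2 \<bar>det M\<bar> \<bar>\<psi>^(M\<^sup>T \<xi>)\<bar>\<^sup>2 d\<xi>\<close>. Since \<open>\<psi>^(M\<^sup>T \<xi>) = \<psi>1^(a \<xi>1) \<psi>2^(a\<^bsup>-1/2\<^esup> (\<xi>2/\<xi>1 - s))\<close>,
  the integral over \<open>s\<close> contributes \<open>\<surd>a\<close> and the integral over \<open>a\<close> becomes the Calderon integral of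
  \<open>\<psi>1\<close>, which is 1. So \<open>f \<mapsto> \<langle>f, \<psi>\<^sub>a\<^sub>s\<^sub>t\<rangle>\<close> is an isometry on \<open>L\<^sup>1 \<inter> L\<^sup>2\<close>, hence on \<open>L\<^sup>2\<close>, and polarization
  gives the weak reproducing formula.\<close>

section \<open>Square integrable functions\<close>

text \<open>With M = \<open>shear_mat a s\<close>, the vector \<open>transpose M *v \<xi>\<close> is
  (a \<xi>1, sqrt a (\<xi>2 - s \<xi>1)). The ratio of its coordinates is affine in s with slope
  -1/sqrt a for every \<xi> with \<xi>1 \<noteq> 0, so integrating in s gives sqrt a; together with
  |det M| = a sqrt a and the weight 1/a^3 this leaves exactly da/a. The obstacle is that an L2
  transform is accessible only through approximating L1 functions. The transform of f is therefore
  used only for f in both L1 and L2, where it is a bounded function. For a general f in L2 its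
  product with the transform of \<psi> at a fixed matrix may fail to be square integrable, so f is
  generalised only after a and s have been integrated out and the coefficient map is an isometry.
  The main norm identity is computed with nonnegative integrals, which can be exchanged before any
  integrability is known; complex integrals return only with polarization. Tonelli in (t, M) calls
  for Borel representatives and for a sigma-finite \<open>shear_measure\<close>.\<close>

definition sq_integrable :: "'a measure \<Rightarrow> ('a \<Rightarrow> complex) \<Rightarrow> bool" where
  "sq_integrable M f \<longleftrightarrow> f \<in> borel_measurable M \<and> integrable M (\<lambda>x. (cmod (f x))\<^sup>2)"

text \<open>Taken over an arbitrary measure because it serves on \<open>lebesgue\<close>, on
  \<open>lborel\<close> and on the product with \<open>shear_measure\<close>. It is 0 on functions
  whose square is not integrable, hence the \<open>sq_integrable\<close> hypotheses in
  estimates.\<close>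

definition norm2 :: "'a measure \<Rightarrow> ('a \<Rightarrow> complex) \<Rightarrow> real" where
  "norm2 M f = sqrt (LINT x|M. (cmod (f x))\<^sup>2)"

lemma borel_measurable_cnj [measurable (raw)]:
  "f \<in> borel_measurable M \<Longrightarrow> (\<lambda>x. cnj (f x)) \<in> borel_measurable M"
  by (rule borel_measurable_continuous_on[OF continuous_on_cnj[OF continuous_on_id]])

lemma norm2_nonneg [simp]: "0 \<le> norm2 M f"
  by (simp add: norm2_def)

lemma norm2_power2: "(norm2 M f)\<^sup>2 = (LINT x|M. (cmod (f x))\<^sup>2)"
  by (simp add: norm2_def)

lemma norm2_minus_commute: "norm2 M (\<lambda>x. f x - g x) = norm2 M (\<lambda>x. g x - f x)"
  by (simp add: norm2_def norm_minus_commute)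

lemma nn_integral_norm2:
  assumes "sq_integrable M f"
  shows "(\<integral>\<^sup>+x. ennreal ((cmod (f x))\<^sup>2) \<partial>M) = ennreal ((norm2 M f)\<^sup>2)"
  using assms unfolding sq_integrable_def norm2_power2 by (intro nn_integral_eq_integral) auto

lemma sq_integrableI_nn:
  assumes "f \<in> borel_measurable M"
    and "(\<integral>\<^sup>+x. ennreal ((cmod (f x))\<^sup>2) \<partial>M) \<le> ennreal c"
  shows "sq_integrable M f"
proof -
  have "(\<integral>\<^sup>+x. ennreal (norm ((cmod (f x))\<^sup>2)) \<partial>M) < \<infinity>"
    using assms(2) le_less_trans[of _ "ennreal c" \<infinity>] by auto
  then show ?thesis
    using assms(1) by (auto simp: sq_integrable_def integrable_iff_bounded)
qed

text \<open>Tonelli yields the squared norm as a nonnegative integral; finiteness and the value of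
  the norm are both read off from it.\<close>

lemma norm2_eqI_nn:
  assumes "f \<in> borel_measurable M"
    and "(\<integral>\<^sup>+x. ennreal ((cmod (f x))\<^sup>2) \<partial>M) = ennreal (c\<^sup>2)" and "0 \<le> c"
  shows "sq_integrable M f" "norm2 M f = c"
proof -
  show f: "sq_integrable M f"
    by (rule sq_integrableI_nn[where c = "c\<^sup>2"]) (use assms in auto)
  have "ennreal ((norm2 M f)\<^sup>2) = ennreal (c\<^sup>2)"
    using nn_integral_norm2[OF f] assms(2) by simp
  then show "norm2 M f = c"
    using assms(3) by (simp add: power2_eq_iff_nonneg)
qed

lemma nn_integral_le_imp_norm2_le:
  assumes "sq_integrable M f" "0 \<le> c"
    and "(\<integral>\<^sup>+x. ennreal ((cmod (f x))\<^sup>2) \<partial>M) \<le> ennreal (c\<^sup>2)"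
  shows "norm2 M f \<le> c"
proof -
  have "(norm2 M f)\<^sup>2 \<le> c\<^sup>2"
    using nn_integral_norm2[OF assms(1)] assms by simp
  then show ?thesis using assms(2) by (rule power2_le_imp_le)
qed

text \<open>Integrating (d |f| - |g|)^2 \<ge> 0 gives a quadratic inequality for every real d, and
  the bound follows from a good choice of d. The optimal d is \<open>?B / ?A\<close>; the cases of
  vanishing norms use other choices.\<close>

lemma Cauchy_Schwarz_integral:
  fixes f g :: "'a \<Rightarrow> complex"
  assumes f: "sq_integrable M f" and g: "sq_integrable M g"
  shows "integrable M (\<lambda>x. f x * cnj (g x))"
    and "(LINT x|M. cmod (f x) * cmod (g x)) \<le> norm2 M f * norm2 M g"
    and "cmod (LINT x|M. f x * cnj (g x)) \<le> norm2 M f * norm2 M g"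
proof -
  have [measurable]: "f \<in> borel_measurable M" "g \<in> borel_measurable M"
    and if2: "integrable M (\<lambda>x. (cmod (f x))\<^sup>2)" and ig2: "integrable M (\<lambda>x. (cmod (g x))\<^sup>2)"
    using f g by (auto simp: sq_integrable_def)
  show I: "integrable M (\<lambda>x. f x * cnj (g x))"
  proof (rule Bochner_Integration.integrable_bound[OF Bochner_Integration.integrable_add[OF if2 ig2]])
    have "a * b \<le> a\<^sup>2 + b\<^sup>2" if "a \<ge> 0" "b \<ge> 0" for a b :: real
      using sum_squares_bound[of a b] mult_nonneg_nonneg[OF that] by linarith
    then show "AE x in M. norm (f x * cnj (g x)) \<le> norm ((cmod (f x))\<^sup>2 + (cmod (g x))\<^sup>2)"
      by (simp add: norm_mult)
  qed measurable
  then have I': "integrable M (\<lambda>x. cmod (f x) * cmod (g x))"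
    using integrable_norm[OF I] by (simp add: norm_mult)
  let ?X = "LINT x|M. cmod (f x) * cmod (g x)" and ?A = "norm2 M f" and ?B = "norm2 M g"
  have key: "2 * d * ?X \<le> d\<^sup>2 * ?A\<^sup>2 + ?B\<^sup>2" for d
  proof -
    have "(LINT x|M. 2 * d * (cmod (f x) * cmod (g x)))
        \<le> (LINT x|M. d\<^sup>2 * (cmod (f x))\<^sup>2 + (cmod (g x))\<^sup>2)"
    proof (rule integral_mono)
      fix x show "2 * d * (cmod (f x) * cmod (g x)) \<le> d\<^sup>2 * (cmod (f x))\<^sup>2 + (cmod (g x))\<^sup>2"
        using sum_squares_bound[of "d * cmod (f x)" "cmod (g x)"] by (simp add: power_mult_distrib mult_ac)
    qed (use I' if2 ig2 in auto)
    then show ?thesis using I' if2 ig2 by (simp add: norm2_power2)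
  qed
  show "?X \<le> ?A * ?B"
  proof (cases "?A = 0")
    case True
    have "?X \<le> 0"
    proof (rule ccontr)
      assume X: "\<not> ?X \<le> 0"
      \<comment> \<open>The quadratic term vanishes, so d may be chosen to make the left side 2 (B^2
        + 1), which exceeds B^2.\<close>
      have "2 * ((?B\<^sup>2 + 1) / ?X) * ?X \<le> ?B\<^sup>2"
        using key[of "(?B\<^sup>2 + 1) / ?X"] unfolding True by simp
      moreover have "2 * ((?B\<^sup>2 + 1) / ?X) * ?X = 2 * (?B\<^sup>2 + 1)" using X by simp
      ultimately have "2 * (?B\<^sup>2 + 1) \<le> ?B\<^sup>2" by (simp only:)
      then show False using zero_le_power2[of ?B] by argo
    qed
    then show ?thesis using True by simp
  next
    case False
    then have A: "?A > 0" using norm2_nonneg[of M f] by linarith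
    then show ?thesis
    proof (cases "?B = 0")
      case True
      have "?X \<le> 0"
      proof (rule ccontr)
        assume X: "\<not> ?X \<le> 0"
        \<comment> \<open>This d reduces the inequality to 2 X^2 \<le> X^2, impossible for X >
          0.\<close>
        have "2 * (?X / ?A\<^sup>2) * ?X \<le> (?X / ?A\<^sup>2)\<^sup>2 * ?A\<^sup>2"
          using key[of "?X / ?A\<^sup>2"] True by simp
        then have "2 * ?X\<^sup>2 \<le> ?X\<^sup>2"
          using A by (simp add: field_simps power2_eq_square)
        then show False using X by (simp add: power2_eq_square)
      qed
      then show ?thesis using True by simp
    next
      case False
      then have B: "?B > 0" using norm2_nonneg[of M g] by linarith
      have "2 * (?B / ?A) * ?X \<le> 2 * (?B / ?A) * (?A * ?B)"
        using key[of "?B / ?A"] A by (simp add: field_simps power2_eq_square)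
      then show ?thesis using A B by (simp add: field_simps)
    qed
  qed
  moreover have "cmod (LINT x|M. f x * cnj (g x)) \<le> ?X"
    using integral_norm_bound[of M "\<lambda>x. f x * cnj (g x)"] by (simp add: norm_mult)
  ultimately show "cmod (LINT x|M. f x * cnj (g x)) \<le> ?A * ?B" by linarith
qed

lemma sq_integrable_add:
  assumes f: "sq_integrable M f" and g: "sq_integrable M g"
  shows "sq_integrable M (\<lambda>x. f x + g x)" "norm2 M (\<lambda>x. f x + g x) \<le> norm2 M f + norm2 M g"
proof -
  have [measurable]: "f \<in> borel_measurable M" "g \<in> borel_measurable M"
    and if2: "integrable M (\<lambda>x. (cmod (f x))\<^sup>2)" and ig2: "integrable M (\<lambda>x. (cmod (g x))\<^sup>2)"
    using f g by (auto simp: sq_integrable_def)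
  have fg: "integrable M (\<lambda>x. cmod (f x) * cmod (g x))"
    using integrable_norm[OF Cauchy_Schwarz_integral(1)[OF f g]] by (simp add: norm_mult)
  have le: "(cmod (f x + g x))\<^sup>2 \<le> (cmod (f x))\<^sup>2 + (cmod (g x))\<^sup>2 + 2 * (cmod (f x) * cmod (g x))" for x
    using power_mono[OF norm_triangle_ineq[of "f x" "g x"], of 2] by (simp add: power2_sum mult_ac)
  have int: "integrable M (\<lambda>x. (cmod (f x))\<^sup>2 + (cmod (g x))\<^sup>2 + 2 * (cmod (f x) * cmod (g x)))"
    using if2 ig2 fg by auto
  have i: "integrable M (\<lambda>x. (cmod (f x + g x))\<^sup>2)"
    by (rule Bochner_Integration.integrable_bound[OF int]) (use le in \<open>auto intro!: AE_I2 order_trans[OF le]\<close>)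
  then show "sq_integrable M (\<lambda>x. f x + g x)" by (simp add: sq_integrable_def)
  have "(norm2 M (\<lambda>x. f x + g x))\<^sup>2 \<le> (LINT x|M. (cmod (f x))\<^sup>2 + (cmod (g x))\<^sup>2 + 2 * (cmod (f x) * cmod (g x)))"
    unfolding norm2_power2 by (rule integral_mono[OF i int le])
  also have "\<dots> = (norm2 M f)\<^sup>2 + (norm2 M g)\<^sup>2 + 2 * (LINT x|M. cmod (f x) * cmod (g x))"
    using if2 ig2 fg by (simp add: norm2_power2)
  also have "\<dots> \<le> (norm2 M f + norm2 M g)\<^sup>2"
    using Cauchy_Schwarz_integral(2)[OF f g] by (simp add: power2_sum)
  finally show "norm2 M (\<lambda>x. f x + g x) \<le> norm2 M f + norm2 M g"
    by (rule power2_le_imp_le) simp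
qed

lemma sq_integrable_cmult:
  assumes "sq_integrable M f"
  shows "sq_integrable M (\<lambda>x. c * f x)" "norm2 M (\<lambda>x. c * f x) = cmod c * norm2 M f"
  using assms by (auto simp: sq_integrable_def norm2_def norm_mult power_mult_distrib real_sqrt_mult)

lemma sq_integrable_diff:
  assumes f: "sq_integrable M f" and g: "sq_integrable M g"
  shows "sq_integrable M (\<lambda>x. f x - g x)" "norm2 M (\<lambda>x. f x - g x) \<le> norm2 M f + norm2 M g"
  using sq_integrable_add[OF f sq_integrable_cmult(1)[OF g, of "-1"]] sq_integrable_cmult(2)[OF g, of "-1"]
  by simp_all

text \<open>Two triangle inequalities bound the difference of the norms by the norm of the
  difference.\<close>

lemma norm2_tendsto:
  assumes w: "sq_integrable M w" and wn: "\<And>n. sq_integrable M (wn n)"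
    and lim: "(\<lambda>n. norm2 M (\<lambda>x. wn n x - w x)) \<longlonglongrightarrow> 0"
  shows "(\<lambda>n. norm2 M (wn n)) \<longlonglongrightarrow> norm2 M w"
proof (rule LIM_zero_cancel, rule Lim_null_comparison[OF _ lim], rule always_eventually, rule allI)
  fix n
  have "norm2 M (wn n) \<le> norm2 M (\<lambda>x. wn n x - w x) + norm2 M w"
    using sq_integrable_add(2)[OF sq_integrable_diff(1)[OF wn[of n] w] w] by simp
  moreover have "norm2 M w \<le> norm2 M (\<lambda>x. wn n x - w x) + norm2 M (wn n)"
    using sq_integrable_diff(2)[OF wn[of n] sq_integrable_diff(1)[OF wn[of n] w]] by simp
  ultimately show "norm (norm2 M (wn n) - norm2 M w) \<le> norm2 M (\<lambda>x. wn n x - w x)"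
    by (simp add: abs_if)
qed

text \<open>Completeness of \<open>L\<^sup>2\<close> is never needed: the limit is given pointwise, and Fatou's lemma shows that
  it is also the limit in \<open>L\<^sup>2\<close>.\<close>

lemma isometry_limit:
  assumes v: "sq_integrable N v" and vn: "\<And>n. sq_integrable N (vn n)"
    and lim: "(\<lambda>n. norm2 N (\<lambda>x. vn n x - v x)) \<longlonglongrightarrow> 0"
    and un: "\<And>n. sq_integrable M (un n)" and u: "u \<in> borel_measurable M"
    and pw: "AE x in M. (\<lambda>n. un n x) \<longlonglongrightarrow> u x"
    and iso: "\<And>n. norm2 M (un n) = norm2 N (vn n)"
    and iso2: "\<And>n m. norm2 M (\<lambda>x. un n x - un m x) = norm2 N (\<lambda>x. vn n x - vn m x)"
  shows "sq_integrable M u" "norm2 M u = norm2 N v"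
    "(\<lambda>n. norm2 M (\<lambda>x. un n x - u x)) \<longlonglongrightarrow> 0"
proof -
  note [measurable] = u
  have [measurable]: "un n \<in> borel_measurable M" for n using un by (auto simp: sq_integrable_def)
  \<comment> \<open>Fatou in m with n fixed: \<open>un m\<close> tends to \<open>u\<close>
    pointwise, while the norms of \<open>un n - un m\<close> equal those of
    \<open>vn n - vn m\<close> and so converge.\<close>
  have le: "(\<integral>\<^sup>+x. ennreal ((cmod (un n x - u x))\<^sup>2) \<partial>M) \<le> ennreal ((norm2 N (\<lambda>x. vn n x - v x))\<^sup>2)" for n
  proof -
    have lm: "(\<lambda>m. norm2 N (\<lambda>x. vn n x - vn m x)) \<longlonglongrightarrow> norm2 N (\<lambda>x. vn n x - v x)"
    proof (rule norm2_tendsto)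
      have "(\<lambda>x. vn n x - vn m x - (vn n x - v x)) = (\<lambda>x. v x - vn m x)" for m by auto
      then show "(\<lambda>m. norm2 N (\<lambda>x. vn n x - vn m x - (vn n x - v x))) \<longlonglongrightarrow> 0"
        using lim by (simp add: norm2_minus_commute[of N v])
    qed (intro sq_integrable_diff v vn)+
    have "(\<integral>\<^sup>+x. ennreal ((cmod (un n x - u x))\<^sup>2) \<partial>M)
        = (\<integral>\<^sup>+x. liminf (\<lambda>m. ennreal ((cmod (un n x - un m x))\<^sup>2)) \<partial>M)"
    proof (rule nn_integral_cong_AE, use pw in eventually_elim)
      fix x assume "(\<lambda>m. un m x) \<longlonglongrightarrow> u x"
      then have "(\<lambda>m. ennreal ((cmod (un n x - un m x))\<^sup>2)) \<longlonglongrightarrow> ennreal ((cmod (un n x - u x))\<^sup>2)"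
        by (intro tendsto_intros)
      then show "ennreal ((cmod (un n x - u x))\<^sup>2) = liminf (\<lambda>m. ennreal ((cmod (un n x - un m x))\<^sup>2))"
        by (rule lim_imp_Liminf[OF trivial_limit_sequentially, symmetric])
    qed
    also have "\<dots> \<le> liminf (\<lambda>m. \<integral>\<^sup>+x. ennreal ((cmod (un n x - un m x))\<^sup>2) \<partial>M)"
      by (rule nn_integral_liminf) measurable
    also have "\<dots> = liminf (\<lambda>m. ennreal ((norm2 N (\<lambda>x. vn n x - vn m x))\<^sup>2))"
      by (simp add: nn_integral_norm2 sq_integrable_diff un iso2)
    also have "\<dots> = ennreal ((norm2 N (\<lambda>x. vn n x - v x))\<^sup>2)"
      by (intro lim_imp_Liminf tendsto_intros lm) simp
    finally show ?thesis .
  qed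
  have d: "sq_integrable M (\<lambda>x. un n x - u x)" for n
    by (rule sq_integrableI_nn[OF _ le]) measurable
  \<comment> \<open>\<open>u\<close> is \<open>un 0\<close> minus \<open>un 0 - u\<close>, both
    already known to be square integrable.\<close>
  show su: "sq_integrable M u"
    using sq_integrable_diff(1)[OF un[of 0] d[of 0]] by simp
  show lim0: "(\<lambda>n. norm2 M (\<lambda>x. un n x - u x)) \<longlonglongrightarrow> 0"
    using lim by (rule Lim_null_comparison[rotated])
      (auto intro!: always_eventually nn_integral_le_imp_norm2_le d le)
  show "norm2 M u = norm2 N v"
    using LIMSEQ_unique[OF norm2_tendsto[OF su un lim0, unfolded iso] norm2_tendsto[OF v vn lim]] .
qed

lemma polarization:
  fixes z w :: complex
  shows "4 * (z * cnj w) = of_real ((cmod (z + w))\<^sup>2) - of_real ((cmod (z - w))\<^sup>2)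
    + \<i> * of_real ((cmod (z + \<i> * w))\<^sup>2) - \<i> * of_real ((cmod (z - \<i> * w))\<^sup>2)"
  unfolding complex_norm_square by (simp add: algebra_simps)

text \<open>Expresses an inner product through four norms, which lets an equality of norms on linear
  combinations pass to inner products.\<close>

lemma integral_polarization:
  assumes f: "sq_integrable M f" and g: "sq_integrable M g"
  shows "4 * (LINT x|M. f x * cnj (g x)) =
    of_real ((norm2 M (\<lambda>x. f x + g x))\<^sup>2) - of_real ((norm2 M (\<lambda>x. f x - g x))\<^sup>2)
    + \<i> * of_real ((norm2 M (\<lambda>x. f x + \<i> * g x))\<^sup>2) - \<i> * of_real ((norm2 M (\<lambda>x. f x - \<i> * g x))\<^sup>2)"
proof -
  note ig = sq_integrable_cmult(1)[OF g, of \<i>]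
  have *: "sq_integrable M h \<Longrightarrow> integrable M (\<lambda>x. complex_of_real ((cmod (h x))\<^sup>2))" for h
    unfolding sq_integrable_def by (intro integrable_of_real) auto
  have i: "integrable M (\<lambda>x. complex_of_real ((cmod (f x + g x))\<^sup>2))"
    "integrable M (\<lambda>x. complex_of_real ((cmod (f x - g x))\<^sup>2))"
    "integrable M (\<lambda>x. complex_of_real ((cmod (f x + \<i> * g x))\<^sup>2))"
    "integrable M (\<lambda>x. complex_of_real ((cmod (f x - \<i> * g x))\<^sup>2))"
    by (intro * sq_integrable_add sq_integrable_diff f g ig)+
  have "4 * (LINT x|M. f x * cnj (g x)) = (LINT x|M. 4 * (f x * cnj (g x)))" by simp
  also have "\<dots> = (LINT x|M. of_real ((cmod (f x + g x))\<^sup>2) - of_real ((cmod (f x - g x))\<^sup>2)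
    + \<i> * of_real ((cmod (f x + \<i> * g x))\<^sup>2) - \<i> * of_real ((cmod (f x - \<i> * g x))\<^sup>2))"
    by (simp only: polarization)
  also have "\<dots> = of_real ((norm2 M (\<lambda>x. f x + g x))\<^sup>2) - of_real ((norm2 M (\<lambda>x. f x - g x))\<^sup>2)
    + \<i> * of_real ((norm2 M (\<lambda>x. f x + \<i> * g x))\<^sup>2) - \<i> * of_real ((norm2 M (\<lambda>x. f x - \<i> * g x))\<^sup>2)"
    using i by (simp add: norm2_power2 del: of_real_power)
  finally show ?thesis .
qed

section \<open>The Fourier transform of integrable functions\<close>

lemma borel_measurable_cis [measurable (raw)]:
  assumes [measurable]: "h \<in> borel_measurable M"
  shows "(\<lambda>x. cis (h x)) \<in> borel_measurable M"
proof -
  have "cis \<in> borel_measurable borel"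
    by (intro borel_measurable_continuous_onI continuous_on_cis continuous_on_id)
  from measurable_compose[OF assms this] show ?thesis .
qed

text \<open>For Borel functions the integral over the completed measure agrees with the one over
  \<open>lborel\<close>, where Fubini on product measures applies directly.\<close>

lemma fourier_lborel:
  assumes [measurable]: "f \<in> borel_measurable borel"
  shows "fourier f \<xi> = (LINT x|lborel. f x * cis (- (2 * pi * (\<xi> \<bullet> x))))"
  unfolding fourier_def by (rule integral_completion) measurable

lemma borel_measurable_fourier [measurable]:
  assumes [measurable]: "f \<in> borel_measurable borel"
  shows "fourier f \<in> borel_measurable borel"
proof -
  have "fourier f = (\<lambda>\<xi>. LINT x|lborel. f x * cis (- (2 * pi * (\<xi> \<bullet> x))))"
    by (simp add: fourier_lborel fun_eq_iff)
  also have "\<dots> \<in> borel_measurable borel"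
    by measurable
  finally show ?thesis .
qed

lemma integrable_mult_cis:
  assumes "integrable M f" "h \<in> borel_measurable M"
  shows "integrable M (\<lambda>x. f x * cis (h x))"
  by (rule Bochner_Integration.integrable_bound[OF assms(1)]) (use assms in \<open>auto simp: norm_mult\<close>)

lemma fourier_diff:
  assumes "integrable lborel f" "integrable lborel g"
  shows "fourier (\<lambda>x. f x - g x) \<xi> = fourier f \<xi> - fourier g \<xi>"
proof -
  have [measurable]: "f \<in> borel_measurable borel" "g \<in> borel_measurable borel"
    using assms[THEN borel_measurable_integrable] by auto
  show ?thesis
    using integrable_mult_cis[OF assms(1), of "\<lambda>x. - (2 * pi * (\<xi> \<bullet> x))"]
      integrable_mult_cis[OF assms(2), of "\<lambda>x. - (2 * pi * (\<xi> \<bullet> x))"]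
    by (simp add: fourier_lborel left_diff_distrib)
qed

lemma cmod_fourier_le:
  assumes "integrable lborel f"
  shows "cmod (fourier f \<xi>) \<le> (LINT x|lborel. cmod (f x))"
proof -
  have "f \<in> borel_measurable borel" using assms by auto
  then show ?thesis
    using integral_norm_bound[of lborel "\<lambda>x. f x * cis (- (2 * pi * (\<xi> \<bullet> x)))"]
    by (simp add: fourier_lborel norm_mult)
qed

section \<open>Reflections, translations and scalings of Lebesgue measure\<close>

lemma lborel_distr_diff:
  fixes x :: "'a::euclidean_space"
  shows "distr lborel borel (\<lambda>t. x - t) = lborel"
  using lborel_affine[of "-1" x] by (simp add: density_1)

lemma integrable_reflect:
  fixes f :: "'a::euclidean_space \<Rightarrow> 'b::{banach, second_countable_topology}"
  assumes "integrable lborel f"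
  shows "integrable lborel (\<lambda>t. f (x - t))"
  by (rule integrable_distr[where M' = borel]) (use assms in \<open>auto simp: lborel_distr_diff\<close>)

lemma integral_reflect:
  fixes f :: "'a::euclidean_space \<Rightarrow> 'b::{banach, second_countable_topology}"
  assumes "f \<in> borel_measurable borel"
  shows "(LINT t|lborel. f (x - t)) = (LINT y|lborel. f y)"
  using integral_distr[of "\<lambda>t. x - t" lborel borel f] assms by (simp add: lborel_distr_diff)

lemma lborel_distr_minus:
  fixes z :: "'a::euclidean_space"
  shows "distr lborel borel (\<lambda>x. x - z) = lborel"
  using lborel_distr_plus[of "- z"] by (simp add: add.commute[of "-z"] cong: distr_cong)

lemma integrable_translate:
  fixes f :: "'a::euclidean_space \<Rightarrow> 'b::{banach, second_countable_topology}"
  assumes "integrable lborel f"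
  shows "integrable lborel (\<lambda>x. f (x - z))"
  by (rule integrable_distr[where M' = borel]) (use assms in \<open>auto simp: lborel_distr_minus\<close>)

lemma integral_translate:
  fixes f :: "'a::euclidean_space \<Rightarrow> 'b::{banach, second_countable_topology}"
  assumes "f \<in> borel_measurable borel"
  shows "(LINT x|lborel. f (x - z)) = (LINT x|lborel. f x)"
  using integral_distr[of "\<lambda>x. x - z" lborel borel f] assms by (simp add: lborel_distr_minus)

lemma integral_scale:
  fixes f :: "'a::euclidean_space \<Rightarrow> 'b::{banach, second_countable_topology}"
  assumes [measurable]: "f \<in> borel_measurable borel" and c: "c > 0"
  shows "(LINT x|lborel. f x) = c ^ DIM('a) *\<^sub>R (LINT x|lborel. f (c *\<^sub>R x))"
proof -
  have "(LINT x|lborel. f x) = (LINT x|density (distr lborel borel (\<lambda>x::'a. c *\<^sub>R x)) (\<lambda>_. ennreal (c ^ DIM('a))). f x)"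
    using lborel_affine[of c "0::'a"] c by simp
  also have "\<dots> = c ^ DIM('a) *\<^sub>R (LINT x|lborel. f (c *\<^sub>R x))"
    using c by (subst integral_density) (auto simp: integral_distr)
  finally show ?thesis .
qed

text \<open>When \<open>g\<close> is a dilate of the generator, \<open>corr f g t\<close> is the
  inner product of \<open>f\<close> with the translate of \<open>g\<close> by t, that is, a wavelet
  coefficient.\<close>

definition corr :: "('a::euclidean_space \<Rightarrow> complex) \<Rightarrow> ('a \<Rightarrow> complex) \<Rightarrow> 'a \<Rightarrow> complex" where
  "corr f g t = (LINT x|lborel. f x * cnj (g (x - t)))"

lemma borel_measurable_corr [measurable]:
  assumes [measurable]: "f \<in> borel_measurable borel" "g \<in> borel_measurable borel"
  shows "corr f g \<in> borel_measurable borel"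
  unfolding corr_def[abs_def] by measurable

text \<open>For fixed x, the reflection t \<mapsto> x - t makes the integral of the absolute value
  over t equal to |f x| times the L1 norm of \<open>g\<close>, which is integrable in x.\<close>

lemma integrable_corr_kernel:
  fixes f g :: "'a::euclidean_space \<Rightarrow> complex"
  assumes f: "integrable lborel f" and g: "integrable lborel g"
  shows "integrable (lborel \<Otimes>\<^sub>M lborel) (\<lambda>(x, t). f x * cnj (g (x - t)))"
proof (rule lborel_pair.Fubini_integrable)
  have [measurable]: "f \<in> borel_measurable borel" "g \<in> borel_measurable borel"
    using f g by auto
  show "(\<lambda>(x, t). f x * cnj (g (x - t))) \<in> borel_measurable (lborel \<Otimes>\<^sub>M lborel)"
    by measurable
  have "(LINT t|lborel. norm (f x * cnj (g (x - t)))) = cmod (f x) * (LINT y|lborel. cmod (g y))" for x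
    using integral_reflect[of "\<lambda>y. cmod (g y)" x] by (simp add: norm_mult)
  then show "integrable lborel (\<lambda>x. LINT t|lborel. norm (case (x, t) of (x, t) \<Rightarrow> f x * cnj (g (x - t))))"
    using f by simp
  show "AE x in lborel. integrable lborel (\<lambda>t. case (x, t) of (x, t) \<Rightarrow> f x * cnj (g (x - t)))"
    using integrable_reflect[OF g] by simp
qed

lemma integrable_corr:
  assumes f: "integrable lborel f" and g: "integrable lborel g"
  shows "integrable lborel (corr f g)"
  using lborel_pair.integrable_fst'[OF lborel_pair.integrable_product_swap[OF integrable_corr_kernel[OF f g]]]
  by (simp add: corr_def[abs_def])

lemma fourier_corr:
  fixes f g :: "'a::euclidean_space \<Rightarrow> complex"
  assumes f: "integrable lborel f" and g: "integrable lborel g"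
  shows "fourier (corr f g) \<xi> = fourier f \<xi> * cnj (fourier g \<xi>)"
proof -
  have [measurable]: "f \<in> borel_measurable borel" "g \<in> borel_measurable borel"
    using f g by auto
  let ?e = "\<lambda>x. cis (- (2 * pi * (\<xi> \<bullet> x)))"
  have "fourier (corr f g) \<xi> = (LINT t|lborel. LINT x|lborel. f x * cnj (g (x - t)) * ?e t)"
    by (simp add: fourier_lborel) (simp add: corr_def)
  also have "\<dots> = (LINT x|lborel. LINT t|lborel. f x * cnj (g (x - t)) * ?e t)"
  proof (rule lborel_pair.Fubini_integral)
    show "integrable (lborel \<Otimes>\<^sub>M lborel) (\<lambda>(x, t). f x * cnj (g (x - t)) * ?e t)"
      using integrable_mult_cis[OF integrable_corr_kernel[OF f g], of "\<lambda>p. - (2 * pi * (\<xi> \<bullet> snd p))"]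
      by (simp add: split_beta')
  qed
  also have "\<dots> = (LINT x|lborel. f x * ?e x * cnj (fourier g \<xi>))"
  proof (rule Bochner_Integration.integral_cong[OF refl])
    fix x
    \<comment> \<open>The character at t is the character at x times the conjugate of the character
      at x - t, so the two functions separate.\<close>
    have eq: "f x * cnj (g (x - t)) * ?e t = (f x * ?e x) * cnj (g (x - t) * ?e (x - t))" for t
      by (simp add: cis_cnj cis_mult inner_diff_right algebra_simps)
    have "(LINT t|lborel. f x * cnj (g (x - t)) * ?e t)
      = (f x * ?e x) * (LINT t|lborel. cnj (g (x - t) * ?e (x - t)))"
      unfolding eq by simp
    also have "(LINT t|lborel. cnj (g (x - t) * ?e (x - t))) = (LINT y|lborel. cnj (g y * ?e y))"
      by (rule integral_reflect[of "\<lambda>y. cnj (g y * ?e y)"]) measurable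
    also have "\<dots> = cnj (fourier g \<xi>)"
      by (subst Bochner_Integration.integral_cnj) (simp only: fourier_lborel[OF \<open>g \<in> borel_measurable borel\<close>])
    finally show "(LINT t|lborel. f x * cnj (g (x - t)) * ?e t) = f x * ?e x * cnj (fourier g \<xi>)" .
  qed
  also have "\<dots> = fourier f \<xi> * cnj (fourier g \<xi>)"
    by (simp add: fourier_lborel)
  finally show ?thesis .
qed

text \<open>Both sides are iterated integrals of f x * g \<xi> against one kernel that is symmetric
  in x and \<xi>. It lets the transform be moved onto a Gaussian, where it is explicit.\<close>

lemma fourier_multiplication_formula:
  fixes f g :: "'a::euclidean_space \<Rightarrow> complex"
  assumes f: "integrable lborel f" and g: "integrable lborel g"
  shows "(LINT \<xi>|lborel. fourier f \<xi> * g \<xi>) = (LINT x|lborel. f x * fourier g x)"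
proof -
  have m[measurable]: "f \<in> borel_measurable borel" "g \<in> borel_measurable borel"
    using f g by auto
  let ?e = "\<lambda>x \<xi>. cis (- (2 * pi * (\<xi> \<bullet> x)))"
  have i: "integrable (lborel \<Otimes>\<^sub>M lborel) (\<lambda>(x, \<xi>). f x * g \<xi> * ?e x \<xi>)"
  proof (rule lborel_pair.Fubini_integrable)
    show "integrable lborel (\<lambda>x. LINT \<xi>|lborel. norm (case (x, \<xi>) of (x, \<xi>) \<Rightarrow> f x * g \<xi> * ?e x \<xi>))"
      using f by (simp add: norm_mult)
    show "AE x in lborel. integrable lborel (\<lambda>\<xi>. case (x, \<xi>) of (x, \<xi>) \<Rightarrow> f x * g \<xi> * ?e x \<xi>)"
      using g by (auto intro!: integrable_mult_cis)
  qed measurable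
  have "(LINT \<xi>|lborel. fourier f \<xi> * g \<xi>) = (LINT \<xi>|lborel. LINT x|lborel. f x * g \<xi> * ?e x \<xi>)"
  proof (rule Bochner_Integration.integral_cong[OF refl])
    fix \<xi>
    have "(LINT x|lborel. f x * g \<xi> * ?e x \<xi>) = (LINT x|lborel. (f x * ?e x \<xi>) * g \<xi>)"
      by (simp only: mult_ac)
    then show "fourier f \<xi> * g \<xi> = (LINT x|lborel. f x * g \<xi> * ?e x \<xi>)"
      by (simp only: integral_mult_left_zero fourier_lborel[OF m(1)])
  qed
  also have "\<dots> = (LINT x|lborel. LINT \<xi>|lborel. f x * g \<xi> * ?e x \<xi>)"
    by (rule lborel_pair.Fubini_integral[OF i])
  also have "\<dots> = (LINT x|lborel. f x * fourier g x)"
    by (simp add: fourier_lborel m mult.assoc inner_commute)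
  finally show ?thesis .
qed

section \<open>Gaussian functions and their Fourier transforms\<close>

context
begin

interpretation product_sigma_finite "\<lambda>_::'a::euclidean_space. lborel :: real measure" ..

text \<open>On a Euclidean space \<open>lborel\<close> is the image of the product of
  one-dimensional measures indexed by \<open>Basis\<close>.\<close>

lemma integral_lborel_prod:
  fixes f :: "'a::euclidean_space \<Rightarrow> real \<Rightarrow> complex"
  assumes "\<And>b. b \<in> Basis \<Longrightarrow> integrable lborel (f b)"
  shows "(LINT x|lborel. (\<Prod>b\<in>Basis. f b (x \<bullet> b))) = (\<Prod>b\<in>Basis. (LINT x|lborel. f b x))"
proof -
  have [measurable]: "b \<in> Basis \<Longrightarrow> f b \<in> borel_measurable borel" for b
    using assms[of b] by auto
  have "(LINT x|lborel. (\<Prod>b\<in>Basis. f b (x \<bullet> b)))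
      = (LINT x|(\<Pi>\<^sub>M b\<in>(Basis::'a set). lborel). (\<Prod>b\<in>Basis. f b (x b)))"
    by (subst lborel_eq) (simp add: integral_distr)
  also have "\<dots> = (\<Prod>b\<in>Basis. (LINT x|lborel. f b x))"
    by (rule product_integral_prod) (use assms in auto)
  finally show ?thesis .
qed

end

text \<open>Density of the standard normal distribution on the space, normalised to integral 1, so
  that its transform comes from the characteristic function in one variable.\<close>

definition gauss :: "'a::euclidean_space \<Rightarrow> real" where
  "gauss x = (1 / sqrt (2 * pi)) ^ DIM('a) * exp (- (norm x)\<^sup>2 / 2)"

lemma borel_measurable_gauss [measurable]: "gauss \<in> borel_measurable borel"
  unfolding gauss_def[abs_def] by measurable

lemma gauss_nonneg: "0 \<le> gauss x"
  by (simp add: gauss_def)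

lemma gauss_prod:
  fixes x :: "'a::euclidean_space"
  shows "gauss x = (\<Prod>b\<in>Basis. std_normal_density (x \<bullet> b))"
proof -
  have "(norm x)\<^sup>2 = (\<Sum>b\<in>Basis. (x \<bullet> b)\<^sup>2)"
    by (simp add: norm_eq_sqrt_inner euclidean_inner[of x x] power2_eq_square sum_nonneg)
  then have "- (norm x)\<^sup>2 / 2 = (\<Sum>b\<in>Basis. - (x \<bullet> b)\<^sup>2 / 2)"
    by (simp add: sum_negf flip: sum_divide_distrib)
  then have "gauss x = (1 / sqrt (2 * pi)) ^ DIM('a) * (\<Prod>b\<in>Basis. exp (- (x \<bullet> b)\<^sup>2 / 2))"
    unfolding gauss_def by (simp only: exp_sum[OF finite_Basis])
  also have "\<dots> = (\<Prod>b\<in>Basis. std_normal_density (x \<bullet> b))"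
    unfolding std_normal_density_def prod.distrib prod_constant ..
  finally show ?thesis .
qed

lemma integral_std_normal_cis:
  "(LINT x|lborel. complex_of_real (std_normal_density x) * cis (- (t * x))) = exp (- (t\<^sup>2) / 2)"
proof -
  have "char std_normal_distribution (- t) = exp (- (t\<^sup>2) / 2)"
    by (simp add: char_std_normal_distribution)
  then show ?thesis
    by (simp add: char_def integral_density cis_conv_exp scaleR_conv_of_real mult_ac)
qed

text \<open>The phase factors over the coordinates as well, so one-dimensional characteristic
  functions multiply. The frequency is angular here; the 2 pi of \<open>fourier\<close> enters by
  scaling in \<open>fourier_gauss\<close>.\<close>

lemma integral_gauss_cis:
  fixes v :: "'a::euclidean_space"
  shows "(LINT x|lborel. complex_of_real (gauss x) * cis (- (v \<bullet> x))) = exp (- (norm v)\<^sup>2 / 2)"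
proof -
  have eq: "complex_of_real (gauss x) * cis (- (v \<bullet> x))
    = (\<Prod>b\<in>Basis. complex_of_real (std_normal_density (x \<bullet> b)) * cis (- ((v \<bullet> b) * (x \<bullet> b))))" for x
    by (simp add: gauss_prod prod.distrib cis_conv_exp exp_sum[symmetric] euclidean_inner[of v x]
      sum_negf sum_distrib_left)
  have "(LINT x|lborel. complex_of_real (gauss x) * cis (- (v \<bullet> x)))
    = (\<Prod>b\<in>Basis. (LINT x|lborel. complex_of_real (std_normal_density x) * cis (- ((v \<bullet> b) * x))))"
    unfolding eq
    by (rule integral_lborel_prod) (auto intro!: integrable_mult_cis)
  also have "\<dots> = complex_of_real (\<Prod>b\<in>Basis. exp (- ((v \<bullet> b)\<^sup>2) / 2))"
    by (simp add: integral_std_normal_cis del: of_real_exp)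
  also have "(\<Prod>b\<in>Basis. exp (- ((v \<bullet> b)\<^sup>2) / 2)) = exp (- (norm v)\<^sup>2 / 2)"
    by (simp add: norm_eq_sqrt_inner euclidean_inner[of v v] power2_eq_square sum_nonneg
       exp_sum[symmetric] sum_negf flip: sum_divide_distrib)
  finally show ?thesis .
qed

text \<open>A non-integrable function has Bochner integral 0 by convention, whereas the formula at
  frequency 0 gives 1.\<close>

lemma integrable_gauss: "integrable lborel gauss"
proof (rule ccontr)
  assume "\<not> integrable lborel (gauss :: 'a \<Rightarrow> real)"
  then have "(LINT x|lborel. gauss (x::'a)) = 0" by (rule not_integrable_integral_eq)
  moreover have "complex_of_real (LINT x|lborel. gauss (x::'a)) = 1"
    using integral_gauss_cis[of "0::'a"] by simp
  ultimately show False by simp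
qed

lemma integral_gauss: "(LINT x|lborel. gauss (x::'a::euclidean_space)) = 1"
proof -
  have "complex_of_real (LINT x|lborel. gauss (x::'a)) = 1"
    using integral_gauss_cis[of "0::'a"] by simp
  then show ?thesis by (simp only: of_real_eq_1_iff)
qed

text \<open>Substituting y = (2 pi / c) \<xi> turns the phase 2 pi (z . \<xi>) into (c z) . y, which
  is why 2 pi / c is the scale. The result is an approximate identity as c grows.\<close>

lemma fourier_gauss:
  fixes z :: "'a::euclidean_space"
  assumes c: "c > 0"
  shows "fourier (\<lambda>\<xi>. complex_of_real (exp (- (norm ((2 * pi / c) *\<^sub>R \<xi>))\<^sup>2 / 2))) z = c ^ DIM('a) * gauss (c *\<^sub>R z)"
proof -
  let ?d = "2 * pi / c" and ?s = "sqrt (2 * pi) ^ DIM('a)"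
  have d: "?d > 0" using c by simp
  have ex: "exp (- (norm y)\<^sup>2 / 2) = ?s * gauss y" for y :: 'a
    by (simp add: gauss_def power_divide)
  let ?h = "\<lambda>y. complex_of_real (gauss y) * cis (- ((c *\<^sub>R z) \<bullet> y))"
  have "fourier (\<lambda>\<xi>. complex_of_real (exp (- (norm (?d *\<^sub>R \<xi>))\<^sup>2 / 2))) z
    = (LINT \<xi>|lborel. complex_of_real ?s * ?h (?d *\<^sub>R \<xi>))"
    unfolding ex using c by (subst fourier_lborel) (auto simp: field_simps intro!: Bochner_Integration.integral_cong)
  also have "\<dots> = complex_of_real ?s * (LINT \<xi>|lborel. ?h (?d *\<^sub>R \<xi>))"
    by simp
  also have "(LINT \<xi>|lborel. ?h (?d *\<^sub>R \<xi>)) = complex_of_real (1 / ?d ^ DIM('a)) * (LINT y|lborel. ?h y)"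
    using d by (subst integral_scale[of ?h ?d]) (auto simp: scaleR_conv_of_real)
  also have "(LINT y|lborel. ?h y) = exp (- (norm (c *\<^sub>R z))\<^sup>2 / 2)"
    by (rule integral_gauss_cis)
  also have "\<dots> = complex_of_real (?s * gauss (c *\<^sub>R z))"
    by (simp only: ex)
  \<comment> \<open>One factor \<open>?s\<close> undoes the normalisation of \<open>gauss\<close> in
    the input, the other introduces it in the output; the Jacobian turns their product into a power
    of c.\<close>
  also have "complex_of_real ?s * (complex_of_real (1 / ?d ^ DIM('a)) * complex_of_real (?s * gauss (c *\<^sub>R z)))
    = complex_of_real ((?s * ?s) / ?d ^ DIM('a) * gauss (c *\<^sub>R z))"
    by simp
  also have "?s * ?s = (2 * pi) ^ DIM('a)"
    unfolding power_mult_distrib[symmetric] by simp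
  also have "(2 * pi) ^ DIM('a) / ?d ^ DIM('a) = (2 * pi / ?d) ^ DIM('a)"
    by (rule power_divide[symmetric])
  also have "2 * pi / ?d = c" using c by simp
  finally show ?thesis by simp
qed

section \<open>Plancherel on \<open>L\<^sup>1 \<inter> L\<^sup>2\<close>\<close>

text \<open>On \<open>U\<close> the translated indicator is eventually 1 at each point because
  \<open>U\<close> is open. Off \<open>U\<close> it may fail to converge at boundary points; that
  part is controlled by the equal measures of \<open>U\<close> and its translate.\<close>

lemma translation_continuous_open:
  fixes U :: "'a::euclidean_space set"
  assumes U: "open U" "emeasure lborel U < \<infinity>" and z: "z \<longlonglongrightarrow> 0"
  shows "(\<lambda>n. LINT x|lborel. \<bar>indicator U (x - z n) - indicator U x :: real\<bar>) \<longlonglongrightarrow> 0"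
proof -
  let ?i = "indicator U :: 'a \<Rightarrow> real"
  have [measurable]: "U \<in> sets borel" using U by auto
  have int: "integrable lborel ?i" using U by (simp add: integrable_indicator_iff)
  note intz = integrable_translate[OF int]
  have "(\<lambda>n. LINT x|lborel. ?i x * (1 - ?i (x - z n))) \<longlonglongrightarrow> (LINT x::'a|lborel. 0 :: real)"
  proof (rule integral_dominated_convergence[where w = ?i])
    show "AE x in lborel. (\<lambda>n. ?i x * (1 - ?i (x - z n))) \<longlonglongrightarrow> 0"
    proof (rule AE_I2)
      fix x
      show "(\<lambda>n. ?i x * (1 - ?i (x - z n))) \<longlonglongrightarrow> 0"
      proof (cases "x \<in> U")
        case True
        have "(\<lambda>n. x - z n) \<longlonglongrightarrow> x" using tendsto_diff[OF tendsto_const z] by simp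
        from topological_tendstoD[OF this U(1) True]
        have "eventually (\<lambda>n. ?i x * (1 - ?i (x - z n)) = 0) sequentially"
          by eventually_elim simp
        then show ?thesis by (rule tendsto_eventually)
      qed simp
    qed
  qed (auto intro!: int split: split_indicator)
  then have lim: "(\<lambda>n. 2 * (LINT x|lborel. ?i x * (1 - ?i (x - z n)))) \<longlonglongrightarrow> 0"
    by (auto intro: tendsto_eq_intros)
  have "(LINT x|lborel. \<bar>?i (x - z n) - ?i x\<bar>) = 2 * (LINT x|lborel. ?i x * (1 - ?i (x - z n)))" for n
  proof -
    have i1: "integrable lborel (\<lambda>x. ?i x * (1 - ?i (x - z n)))"
      by (rule Bochner_Integration.integrable_bound[OF int]) (auto split: split_indicator)
    \<comment> \<open>For indicator values u and v, |v - u| = 2 u (1 - v) + (v - u); the last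
      difference integrates to 0 by translation invariance.\<close>
    have "(LINT x|lborel. \<bar>?i (x - z n) - ?i x\<bar>)
      = (LINT x|lborel. 2 * (?i x * (1 - ?i (x - z n))) + (?i (x - z n) - ?i x))"
      by (intro Bochner_Integration.integral_cong) (auto split: split_indicator)
    also have "\<dots> = 2 * (LINT x|lborel. ?i x * (1 - ?i (x - z n)))
        + ((LINT x|lborel. ?i (x - z n)) - (LINT x|lborel. ?i x))"
      using i1 int intz[of "z n"] by simp
    also have "(LINT x|lborel. ?i (x - z n)) = (LINT x|lborel. ?i x)"
      by (rule integral_translate) measurable
    finally show ?thesis by simp
  qed
  then show ?thesis using lim by simp
qed

text \<open>Three-epsilon argument in which translation invariance makes the two outer errors equal.
  It serves once to pass from open to Borel sets and once to pass to limits.\<close>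

lemma translation_continuous_approx:
  fixes f :: "'a::euclidean_space \<Rightarrow> 'b::{banach, second_countable_topology}"
  assumes f: "integrable lborel f"
    and approx: "\<And>e::real. e > 0 \<Longrightarrow> \<exists>g. integrable lborel g \<and> (LINT x|lborel. norm (f x - g x)) < e \<and>
       (\<lambda>n. LINT x|lborel. norm (g (x - z n) - g x)) \<longlonglongrightarrow> 0"
  shows "(\<lambda>n. LINT x|lborel. norm (f (x - z n) - f x)) \<longlonglongrightarrow> 0"
proof (rule LIMSEQ_I)
  fix e :: real assume "e > 0"
  then obtain g where g: "integrable lborel g" "(LINT x|lborel. norm (f x - g x)) < e / 3"
    and lim: "(\<lambda>n. LINT x|lborel. norm (g (x - z n) - g x)) \<longlonglongrightarrow> 0"
    using approx[of "e / 3"] by auto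
  obtain N where N: "\<And>n. n \<ge> N \<Longrightarrow> (LINT x|lborel. norm (g (x - z n) - g x)) < e / 3"
    using LIMSEQ_D[OF lim, of "e / 3"] \<open>e > 0\<close> by fastforce
  have "norm ((LINT x|lborel. norm (f (x - z n) - f x)) - 0) < e" if n: "n \<ge> N" for n
  proof -
    note t = integrable_translate[OF f, of "z n"] integrable_translate[OF g(1), of "z n"]
    have m: "(\<lambda>x. norm (f x - g x)) \<in> borel_measurable borel"
      using f g(1) by (auto dest!: borel_measurable_integrable)
    have "(LINT x|lborel. norm (f (x - z n) - f x)) \<le> (LINT x|lborel. norm (f (x - z n) - g (x - z n))
        + norm (g (x - z n) - g x) + norm (f x - g x))"
    proof (rule integral_mono)
      fix x
      show "norm (f (x - z n) - f x) \<le> norm (f (x - z n) - g (x - z n))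
        + norm (g (x - z n) - g x) + norm (f x - g x)"
        using norm_triangle_ineq[of "f (x - z n) - g (x - z n) + (g (x - z n) - g x)" "g x - f x"]
          norm_triangle_ineq[of "f (x - z n) - g (x - z n)" "g (x - z n) - g x"]
        by (simp add: norm_minus_commute)
    qed (use f g t in auto)
    also have "\<dots> = (LINT x|lborel. norm (f (x - z n) - g (x - z n)))
        + (LINT x|lborel. norm (g (x - z n) - g x)) + (LINT x|lborel. norm (f x - g x))"
      using f g t by simp
    also have "(LINT x|lborel. norm (f (x - z n) - g (x - z n))) = (LINT x|lborel. norm (f x - g x))"
      by (rule integral_translate[OF m])
    also have "\<dots> + (LINT x|lborel. norm (g (x - z n) - g x)) + \<dots> < e"
      using g(2) N[OF n] by simp
    finally show ?thesis by simp
  qed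
  then show "\<exists>N. \<forall>n\<ge>N. norm ((LINT x|lborel. norm (f (x - z n) - f x)) - 0) < e" by blast
qed

text \<open>Outer regularity reduces indicators of Borel sets to those of open sets; sums and
  dominated limits then reach all integrable functions.\<close>

lemma L1_translation_continuous:
  fixes f :: "'a::euclidean_space \<Rightarrow> complex"
  assumes "integrable lborel f" and z: "z \<longlonglongrightarrow> 0"
  shows "(\<lambda>n. LINT x|lborel. norm (f (x - z n) - f x)) \<longlonglongrightarrow> 0"
  using assms(1)
proof (induction rule: integrable_induct)
  case (base A c)
  then have [measurable]: "A \<in> sets borel" by simp
  have iA: "integrable lborel (\<lambda>x. indicator A x *\<^sub>R c)"
    using base by (intro integrable_scaleR_left) (simp_all add: integrable_indicator_iff)
  show ?case
  proof (rule translation_continuous_approx[OF iA])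
    fix e :: real assume "e > 0"
    \<comment> \<open>The extra 1 keeps the denominator positive for c = 0 and makes the final bound
      d |c| < e strict.\<close>
    define d where "d = e / (cmod c + 1)"
    have "d > 0" using \<open>e > 0\<close> by (simp add: d_def add_nonneg_pos)
    obtain U where U: "open U" "A \<subseteq> U" "emeasure lborel (U - A) < d"
      using outer_regular_lborel[of A d] \<open>d > 0\<close> by auto
    have [measurable]: "U \<in> sets borel" using U by auto
    have "emeasure lborel U \<le> emeasure lborel A + emeasure lborel (U - A)"
      using emeasure_subadditive[of A lborel "U - A"] U(2) by (simp add: Un_absorb1)
    also have "\<dots> < \<infinity>" using base U(3) by (auto simp: less_top[symmetric])
    finally have fin: "emeasure lborel U < \<infinity>" .
    have iU: "integrable lborel (\<lambda>x. indicator U x *\<^sub>R c)"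
      using fin by (intro integrable_scaleR_left) (simp_all add: integrable_indicator_iff)
    have "(LINT x|lborel. norm (indicator A x *\<^sub>R c - indicator U x *\<^sub>R c))
        = (LINT x|lborel. indicator (U - A) x * cmod c)"
      using U(2) by (intro Bochner_Integration.integral_cong) (auto split: split_indicator)
    also have "\<dots> = measure lborel (U - A) * cmod c"
      by simp
    also have "\<dots> \<le> d * cmod c"
      using U(3) \<open>d > 0\<close> by (intro mult_right_mono) (auto simp: measure_def enn2real_leI less_imp_le)
    also have "\<dots> < e"
    proof -
      have "cmod c / (cmod c + 1) < 1" by (simp add: add_nonneg_pos)
      then have "e * (cmod c / (cmod c + 1)) < e * 1" using \<open>e > 0\<close> by (rule mult_strict_left_mono)
      then show ?thesis by (simp add: d_def)
    qed
    finally have le: "(LINT x|lborel. norm (indicator A x *\<^sub>R c - indicator U x *\<^sub>R c)) < e" .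
    have "(\<lambda>n. (LINT x|lborel. \<bar>indicator U (x - z n) - indicator U x :: real\<bar>) * cmod c) \<longlonglongrightarrow> 0 * cmod c"
      by (intro tendsto_mult translation_continuous_open U fin z tendsto_const)
    then have "(\<lambda>n. LINT x|lborel. norm (indicator U (x - z n) *\<^sub>R c - indicator U x *\<^sub>R c)) \<longlonglongrightarrow> 0"
      by (simp add: scaleR_left_diff_distrib[symmetric])
    with iU le show "\<exists>g. integrable lborel g \<and> (LINT x|lborel. norm (indicator A x *\<^sub>R c - g x)) < e \<and>
       (\<lambda>n. LINT x|lborel. norm (g (x - z n) - g x)) \<longlonglongrightarrow> 0" by blast
  qed
next
  case (add f g)
  have "(\<lambda>n. (LINT x|lborel. norm (f (x - z n) - f x)) + (LINT x|lborel. norm (g (x - z n) - g x))) \<longlonglongrightarrow> 0"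
    using tendsto_add[OF add.IH] by simp
  then show ?case
  proof (rule Lim_null_comparison[rotated], intro always_eventually allI)
    fix n
    note t = integrable_translate[OF add.hyps(1), of "z n"] integrable_translate[OF add.hyps(2), of "z n"]
    have "(LINT x|lborel. norm (f (x - z n) + g (x - z n) - (f x + g x)))
      \<le> (LINT x|lborel. norm (f (x - z n) - f x) + norm (g (x - z n) - g x))"
    proof (rule integral_mono)
      fix x show "norm (f (x - z n) + g (x - z n) - (f x + g x)) \<le> norm (f (x - z n) - f x) + norm (g (x - z n) - g x)"
        using norm_triangle_ineq[of "f (x - z n) - f x" "g (x - z n) - g x"] by (simp add: algebra_simps)
    qed (use t add.hyps in auto)
    also have "\<dots> = (LINT x|lborel. norm (f (x - z n) - f x)) + (LINT x|lborel. norm (g (x - z n) - g x))"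
      using t add.hyps by simp
    finally show "norm (LINT x|lborel. norm (f (x - z n) + g (x - z n) - (f x + g x)))
      \<le> (LINT x|lborel. norm (f (x - z n) - f x)) + (LINT x|lborel. norm (g (x - z n) - g x))" by simp
  qed
next
  case (lim f s)
  \<comment> \<open>The approximants satisfy |s i x| \<le> 2 |f x|, hence the majorant 3 |f
    x|.\<close>
  have "(\<lambda>i. LINT x|lborel. norm (f x - s i x)) \<longlonglongrightarrow> (LINT x::'a|lborel. 0 :: real)"
  proof (rule integral_dominated_convergence[where w = "\<lambda>x. 3 * norm (f x)"])
    show "AE x in lborel. (\<lambda>i. norm (f x - s i x)) \<longlonglongrightarrow> 0"
    proof (rule AE_I2)
      fix x
      have "(\<lambda>i. norm (f x - s i x)) \<longlonglongrightarrow> norm (f x - f x)"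
        by (intro tendsto_intros lim.hyps) simp
      then show "(\<lambda>i. norm (f x - s i x)) \<longlonglongrightarrow> 0" by simp
    qed
    show "AE x in lborel. norm (norm (f x - s i x)) \<le> 3 * norm (f x)" for i
    proof (rule AE_I2)
      fix x show "norm (norm (f x - s i x)) \<le> 3 * norm (f x)"
        using norm_triangle_ineq4[of "f x" "s i x"] lim.hyps(3)[of x i] by simp
    qed
  qed (use lim.hyps in \<open>auto dest!: borel_measurable_integrable\<close>)
  then have lim0: "(\<lambda>i. LINT x|lborel. norm (f x - s i x)) \<longlonglongrightarrow> 0" by simp
  show ?case
  proof (rule translation_continuous_approx[OF lim.hyps(4)])
    fix e :: real assume "e > 0"
    then obtain i where "(LINT x|lborel. norm (f x - s i x)) < e"
      using LIMSEQ_D[OF lim0, of e] by fastforce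
    then show "\<exists>g. integrable lborel g \<and> (LINT x|lborel. norm (f x - g x)) < e \<and>
       (\<lambda>n. LINT x|lborel. norm (g (x - z n) - g x)) \<longlonglongrightarrow> 0"
      using lim.hyps(1)[of i] lim.IH[of i] by blast
  qed
qed

text \<open>As \<open>f\<close> is bounded by \<open>B\<close>, the distance of the correlation from
  its value at 0, the squared norm, is at most \<open>B\<close> times the L1 distance between
  \<open>f\<close> and its translate.\<close>

lemma corr_self_tendsto:
  fixes f :: "'a::euclidean_space \<Rightarrow> complex"
  assumes f: "integrable lborel f" and B: "\<And>x. cmod (f x) \<le> B" and z: "z \<longlonglongrightarrow> 0"
  shows "(\<lambda>n. corr f f (z n)) \<longlonglongrightarrow> of_real ((norm2 lborel f)\<^sup>2)"
proof (rule LIM_zero_cancel, rule Lim_null_comparison)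
  have [measurable]: "f \<in> borel_measurable borel" using f by auto
  have B0: "0 \<le> B" using B[of 0] norm_ge_zero[of "f 0"] by linarith
  show "(\<lambda>n. B * (LINT x|lborel. norm (f (x - z n) - f x))) \<longlonglongrightarrow> 0"
    using tendsto_mult[OF tendsto_const L1_translation_continuous[OF f z]] by simp
  show "\<forall>\<^sub>F n in sequentially. norm (corr f f (z n) - of_real ((norm2 lborel f)\<^sup>2))
      \<le> B * (LINT x|lborel. norm (f (x - z n) - f x))"
  proof (intro always_eventually allI)
    fix n
    have bd: "integrable lborel (\<lambda>x. f x * cnj (g x))" if "integrable lborel g" for g
    proof (rule Bochner_Integration.integrable_bound)
      show "integrable lborel (\<lambda>x. B * cmod (g x))" using that by simp
      show "AE x in lborel. norm (f x * cnj (g x)) \<le> norm (B * cmod (g x))"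
        using B B0 by (auto simp: norm_mult mult_right_mono)
    qed (use that in \<open>auto dest!: borel_measurable_integrable\<close>)
    have i: "integrable lborel (\<lambda>x. f x * cnj (f (x - z n)))" "integrable lborel (\<lambda>x. f x * cnj (f x))"
      by (intro bd integrable_translate f)+
    have "of_real ((norm2 lborel f)\<^sup>2) = (LINT x|lborel. f x * cnj (f x))"
      unfolding norm2_power2 integral_complex_of_real[symmetric] complex_norm_square ..
    then have "corr f f (z n) - of_real ((norm2 lborel f)\<^sup>2) = (LINT x|lborel. f x * cnj (f (x - z n) - f x))"
      using i by (simp add: corr_def right_diff_distrib)
    also have "norm \<dots> \<le> (LINT x|lborel. norm (f x * cnj (f (x - z n) - f x)))"
      by (rule integral_norm_bound)
    also have "\<dots> \<le> (LINT x|lborel. B * norm (f (x - z n) - f x))"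
    proof (rule integral_mono)
      show "integrable lborel (\<lambda>x. norm (f x * cnj (f (x - z n) - f x)))"
        by (intro integrable_norm bd Bochner_Integration.integrable_diff integrable_translate f)
      show "integrable lborel (\<lambda>x. B * norm (f (x - z n) - f x))"
        using f integrable_translate[OF f, of "z n"] by auto
      fix x show "norm (f x * cnj (f (x - z n) - f x)) \<le> B * norm (f (x - z n) - f x)"
        using B[of x] by (simp add: norm_mult mult_right_mono del: complex_cnj_diff)
    qed
    finally show "norm (corr f f (z n) - of_real ((norm2 lborel f)\<^sup>2))
      \<le> B * (LINT x|lborel. norm (f (x - z n) - f x))" by simp
  qed
qed

lemma bounded_imp_sq_integrable:
  assumes f: "integrable M f" and B: "\<And>x. cmod (f x) \<le> B"
  shows "sq_integrable M f"
  unfolding sq_integrable_def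
proof
  show m: "f \<in> borel_measurable M" using f by auto
  show "integrable M (\<lambda>x. (cmod (f x))\<^sup>2)"
  proof (rule Bochner_Integration.integrable_bound)
    show "integrable M (\<lambda>x. B * cmod (f x))" using f by auto
    have "(cmod (f x))\<^sup>2 \<le> B * cmod (f x)" for x
      using B[of x] by (simp add: power2_eq_square mult_right_mono)
    then show "AE x in M. norm ((cmod (f x))\<^sup>2) \<le> norm (B * cmod (f x))"
      by (auto intro: order_trans[OF _ abs_ge_self])
  qed (use m in measurable)
qed

text \<open>Pair \<open>\<bar>f^\<bar>\<^sup>2\<close>, the transform of the autocorrelation \<open>k\<close>, with a wide Gaussian: by the
  multiplication formula this is an average of \<open>k\<close> against an approximate identity and tends to
  \<open>k(0) = \<parallel>f\<parallel>\<^sup>2\<close>. Boundedness of \<open>f\<close> makes \<open>k\<close> continuous at 0 by continuity of translations in \<open>L\<^sup>1\<close>.\<close>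

lemma Plancherel_bounded:
  fixes f :: "'a::euclidean_space \<Rightarrow> complex"
  assumes f: "integrable lborel f" and B: "\<And>x. cmod (f x) \<le> B"
  shows "sq_integrable lborel (fourier f)" "norm2 lborel (fourier f) = norm2 lborel f"
proof -
  have m[measurable]: "f \<in> borel_measurable borel" using f by auto
  define k where "k = corr f f"
  have ik: "integrable lborel k" unfolding k_def by (rule integrable_corr[OF f f])
  then have mk[measurable]: "k \<in> borel_measurable borel" by auto
  have kB: "cmod (k z) \<le> B * (LINT x|lborel. cmod (f x))" for z
  proof -
    have "cmod (k z) \<le> (LINT x|lborel. norm (f x * cnj (f (x - z))))"
      unfolding k_def corr_def by (rule integral_norm_bound)
    also have "\<dots> \<le> (LINT x|lborel. B * cmod (f x))"
    proof (rule integral_mono_AE')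
      show "AE x in lborel. norm (f x * cnj (f (x - z))) \<le> B * cmod (f x)"
        using B by (auto simp: norm_mult mult.commute[of B] intro!: mult_left_mono)
      show "AE x in lborel. 0 \<le> B * cmod (f x)"
        using B by (auto intro!: mult_nonneg_nonneg intro: order_trans[OF norm_ge_zero])
    qed (use f in auto)
    finally show ?thesis by simp
  qed
  \<comment> \<open>The scale 2 pi / (n + 1) makes the transform the approximate identity of
    \<open>fourier_gauss\<close> with c = n + 1. \<open>Suc\<close> keeps c positive, and the values
    increase to 1 with n.\<close>
  define \<phi> where "\<phi> n \<xi> = exp (- (norm ((2 * pi / real (Suc n)) *\<^sub>R \<xi>))\<^sup>2 / 2)" for n and \<xi> :: 'a
  have m\<phi>[measurable]: "\<phi> n \<in> borel_measurable borel" for n unfolding \<phi>_def[abs_def] by measurable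
  have \<phi>_int: "integrable lborel (\<phi> n)" for n
  proof -
    have "\<phi> n = (\<lambda>\<xi>. sqrt (2 * pi) ^ DIM('a) * gauss ((2 * pi / real (Suc n)) *\<^sub>R \<xi>))"
      by (auto simp: \<phi>_def gauss_def power_divide)
    \<comment> \<open>Were it not integrable, its integral would be 0 by convention, and scaling
      would force the integral of \<open>gauss\<close>, which is 1, to be 0.\<close>
    moreover have "integrable lborel (\<lambda>\<xi>::'a. gauss ((2 * pi / real (Suc n)) *\<^sub>R \<xi>))"
    proof (rule ccontr)
      assume "\<not> ?thesis"
      then have "(LINT \<xi>::'a|lborel. gauss ((2 * pi / real (Suc n)) *\<^sub>R \<xi>)) = 0"
        by (rule not_integrable_integral_eq)
      then show False
        using integral_scale[of "gauss :: 'a \<Rightarrow> real" "2 * pi / real (Suc n)"] by (simp add: integral_gauss)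
    qed
    ultimately show ?thesis by simp
  qed
  let ?F = "\<lambda>n \<xi>. (cmod (fourier f \<xi>))\<^sup>2 * \<phi> n \<xi>"
  have F_eq: "complex_of_real (LINT \<xi>|lborel. ?F n \<xi>)
      = (LINT w|lborel. k ((1 / real (Suc n)) *\<^sub>R w) * complex_of_real (gauss w))" for n
  proof -
    let ?c = "real (Suc n)"
    have "complex_of_real (LINT \<xi>|lborel. ?F n \<xi>) = (LINT \<xi>|lborel. fourier k \<xi> * complex_of_real (\<phi> n \<xi>))"
      unfolding k_def by (subst integral_complex_of_real[symmetric]) (simp add: fourier_corr f complex_norm_square del: of_real_power)
    also have "\<dots> = (LINT z|lborel. k z * fourier (\<lambda>\<xi>. complex_of_real (\<phi> n \<xi>)) z)"
      by (rule fourier_multiplication_formula[OF ik]) (use \<phi>_int in auto)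
    also have "\<dots> = (LINT z|lborel. of_real (?c ^ DIM('a)) * (k z * complex_of_real (gauss (?c *\<^sub>R z))))"
      unfolding \<phi>_def by (subst fourier_gauss) (auto simp: mult_ac)
    also have "\<dots> = of_real (?c ^ DIM('a)) * (LINT z|lborel. k z * complex_of_real (gauss (?c *\<^sub>R z)))"
      by (rule integral_mult_right_zero)
    \<comment> \<open>The substitution w = (n + 1) z absorbs the power of n + 1 and moves the
      scaling into the argument of \<open>k\<close>, where it shrinks to 0.\<close>
    also have "\<dots> = (LINT w|lborel. k ((1 / ?c) *\<^sub>R w) * complex_of_real (gauss w))"
      by (subst integral_scale[of "\<lambda>w. k ((1 / ?c) *\<^sub>R w) * complex_of_real (gauss w)" ?c])
        (auto simp: scaleR_conv_of_real)
    finally show ?thesis .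
  qed
  have "(\<lambda>n. LINT w|lborel. k ((1 / real (Suc n)) *\<^sub>R w) * complex_of_real (gauss w))
    \<longlonglongrightarrow> (LINT w::'a|lborel. of_real ((norm2 lborel f)\<^sup>2) * complex_of_real (gauss w))"
  proof (rule integral_dominated_convergence)
    show "integrable lborel (\<lambda>w::'a. (B * (LINT x|lborel. cmod (f x))) * gauss w)"
      by (simp add: integrable_gauss)
    show "AE w in lborel. cmod (k ((1 / real (Suc n)) *\<^sub>R w) * complex_of_real (gauss w))
        \<le> (B * (LINT x|lborel. cmod (f x))) * gauss w" for n
      using kB by (auto simp: norm_mult gauss_nonneg intro!: mult_right_mono)
    show "AE w in lborel. (\<lambda>n. k ((1 / real (Suc n)) *\<^sub>R w) * complex_of_real (gauss w))
        \<longlonglongrightarrow> of_real ((norm2 lborel f)\<^sup>2) * complex_of_real (gauss w)"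
    proof (rule AE_I2, rule tendsto_mult[OF _ tendsto_const])
      fix w :: 'a
      have "(\<lambda>n. (1 / real (Suc n)) *\<^sub>R w) \<longlonglongrightarrow> 0 *\<^sub>R w"
        by (intro tendsto_scaleR tendsto_const LIMSEQ_Suc[OF lim_1_over_n])
      then show "(\<lambda>n. k ((1 / real (Suc n)) *\<^sub>R w)) \<longlonglongrightarrow> of_real ((norm2 lborel f)\<^sup>2)"
        unfolding k_def by (intro corr_self_tendsto[OF f B]) simp
    qed
  qed measurable
  then have "(\<lambda>n. complex_of_real (LINT \<xi>|lborel. ?F n \<xi>)) \<longlonglongrightarrow> of_real ((norm2 lborel f)\<^sup>2)"
    by (simp add: F_eq integral_gauss del: of_real_power)
  then have lim: "(\<lambda>n. LINT \<xi>|lborel. ?F n \<xi>) \<longlonglongrightarrow> (norm2 lborel f)\<^sup>2"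
    by (simp only: tendsto_of_real_iff)
  have Fint: "integrable lborel (?F n)" for n
  proof (rule Bochner_Integration.integrable_bound)
    show "integrable lborel (\<lambda>\<xi>. (LINT x|lborel. cmod (f x))\<^sup>2 * \<phi> n \<xi>)" using \<phi>_int by simp
    show "AE \<xi> in lborel. norm (?F n \<xi>) \<le> norm ((LINT x|lborel. cmod (f x))\<^sup>2 * \<phi> n \<xi>)"
      using cmod_fourier_le[OF f] by (auto simp: \<phi>_def intro!: mult_right_mono power_mono)
  qed measurable
  \<comment> \<open>Monotone convergence is the right limit theorem: the integrability of
    |\<open>fourier f\<close>|^2 is part of the conclusion, so no majorant is at hand.\<close>
  have mono: "mono (\<lambda>n. ?F n \<xi>)" for \<xi>
  proof (rule monoI)
    fix i j :: nat assume "i \<le> j"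
    then have "norm ((2 * pi / real (Suc j)) *\<^sub>R \<xi>) \<le> norm ((2 * pi / real (Suc i)) *\<^sub>R \<xi>)"
      by (auto intro!: mult_right_mono divide_left_mono)
    then have "\<phi> i \<xi> \<le> \<phi> j \<xi>" unfolding \<phi>_def by (simp add: power_mono)
    then show "?F i \<xi> \<le> ?F j \<xi>" by (rule mult_left_mono) simp
  qed
  have limF: "(\<lambda>n. ?F n \<xi>) \<longlonglongrightarrow> (cmod (fourier f \<xi>))\<^sup>2" for \<xi>
  proof -
    have "(\<lambda>n. 2 * pi * (1 / real (Suc n))) \<longlonglongrightarrow> 2 * pi * 0"
      by (intro tendsto_mult tendsto_const LIMSEQ_Suc[OF lim_1_over_n])
    then have "(\<lambda>n. ?F n \<xi>) \<longlonglongrightarrow> (cmod (fourier f \<xi>))\<^sup>2 * exp (- (norm ((2 * pi * 0) *\<^sub>R \<xi>))\<^sup>2 / 2)"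
      unfolding \<phi>_def by (intro tendsto_intros) auto
    then show ?thesis by simp
  qed
  have int: "integrable lborel (\<lambda>\<xi>. (cmod (fourier f \<xi>))\<^sup>2)"
    and eq: "(LINT \<xi>|lborel. (cmod (fourier f \<xi>))\<^sup>2) = (norm2 lborel f)\<^sup>2"
    using integral_monotone_convergence_nonneg[OF Fint _ _ _ lim, of "\<lambda>\<xi>. (cmod (fourier f \<xi>))\<^sup>2"] mono limF
    by (auto simp: \<phi>_def)
  show "sq_integrable lborel (fourier f)" using int by (simp add: sq_integrable_def)
  show "norm2 lborel (fourier f) = norm2 lborel f"
    using eq unfolding norm2_def by simp
qed

text \<open>The truncation error is either 0 or \<open>f\<close> in modulus, so |f|^2 is a majorant.
  Level sets of |f| will produce bounded functions, and balls will produce functions of bounded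
  support.\<close>

lemma norm2_truncate:
  assumes f: "sq_integrable M f" and A: "\<And>n. A n \<in> sets M"
    and ev: "\<And>x. eventually (\<lambda>n. x \<in> A n) sequentially"
  shows "(\<lambda>n. norm2 M (\<lambda>x. indicator (A n) x * f x - f x)) \<longlonglongrightarrow> 0"
    "sq_integrable M (\<lambda>x. indicator (A n) x * f x)"
proof -
  note [measurable] = A
  have [measurable]: "f \<in> borel_measurable M" and i: "integrable M (\<lambda>x. (cmod (f x))\<^sup>2)"
    using f by (auto simp: sq_integrable_def)
  have "(\<lambda>n. LINT x|M. (cmod (indicator (A n) x * f x - f x))\<^sup>2) \<longlonglongrightarrow> (LINT x|M. 0 :: real)"
  proof (rule integral_dominated_convergence[OF _ _ i])
    show "AE x in M. (\<lambda>n. (cmod (indicator (A n) x * f x - f x))\<^sup>2) \<longlonglongrightarrow> 0"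
    proof (intro AE_I2 tendsto_eventually)
      fix x
      show "eventually (\<lambda>n. (cmod (indicator (A n) x * f x - f x))\<^sup>2 = 0) sequentially"
        using ev[of x] by eventually_elim simp
    qed
  qed (auto split: split_indicator)
  from tendsto_real_sqrt[OF this]
  show "(\<lambda>n. norm2 M (\<lambda>x. indicator (A n) x * f x - f x)) \<longlonglongrightarrow> 0"
    unfolding norm2_def by simp
  show "sq_integrable M (\<lambda>x. indicator (A n) x * f x)"
    unfolding sq_integrable_def
    by (auto intro!: Bochner_Integration.integrable_bound[OF i] split: split_indicator)
qed

text \<open>Truncation on {|f| \<le> n} makes \<open>f\<close> bounded. Domination by |f| gives
  convergence of the transforms at every frequency, and L2 convergence of the truncations is the
  other input of \<open>isometry_limit\<close>.\<close>

theorem Plancherel_L1_L2: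
  fixes f :: "'a::euclidean_space \<Rightarrow> complex"
  assumes f: "integrable lborel f" and f2: "sq_integrable lborel f"
  shows "sq_integrable lborel (fourier f)" "norm2 lborel (fourier f) = norm2 lborel f"
proof -
  have m[measurable]: "f \<in> borel_measurable borel" using f by auto
  define A where "A n = {x. cmod (f x) \<le> real n}" for n
  have mA[measurable]: "A n \<in> sets borel" for n unfolding A_def by measurable
  define h where "h n x = indicator (A n) x * f x" for n x
  have hm[measurable]: "h n \<in> borel_measurable borel" for n unfolding h_def[abs_def] by measurable
  have ev: "eventually (\<lambda>n. x \<in> A n) sequentially" for x
    unfolding A_def using eventually_ge_at_top[of "nat \<lceil>cmod (f x)\<rceil>"]
    by eventually_elim (simp add: nat_le_iff ceiling_le_iff)
  have hf: "cmod (h n x) \<le> cmod (f x)" for n x by (auto simp: h_def split: split_indicator)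
  have hn: "cmod (h n x) \<le> real n" for n x by (auto simp: h_def A_def split: split_indicator)
  have hi: "integrable lborel (h n)" for n
    by (rule Bochner_Integration.integrable_bound[OF f]) (auto simp: hf)
  have hl: "(\<lambda>n. h n x) \<longlonglongrightarrow> f x" for x
    by (rule tendsto_eventually, use ev[of x] in eventually_elim) (simp add: h_def)
  have h2: "sq_integrable lborel (h n)" for n by (rule bounded_imp_sq_integrable[OF hi hn])
  have pw: "(\<lambda>n. fourier (h n) \<xi>) \<longlonglongrightarrow> fourier f \<xi>" for \<xi>
    unfolding fourier_lborel[OF m] fourier_lborel[OF hm]
  proof (rule integral_dominated_convergence[where w = "\<lambda>x. cmod (f x)"])
    show "AE x in lborel. (\<lambda>n. h n x * cis (- (2 * pi * (\<xi> \<bullet> x)))) \<longlonglongrightarrow> f x * cis (- (2 * pi * (\<xi> \<bullet> x)))"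
      by (intro AE_I2 tendsto_intros hl)
  qed (use f hf in \<open>auto simp: norm_mult\<close>)
  have lim: "(\<lambda>n. norm2 lborel (\<lambda>x. h n x - f x)) \<longlonglongrightarrow> 0"
    unfolding h_def using norm2_truncate(1)[OF f2 _ ev] mA by simp
  have diff: "norm2 lborel (\<lambda>\<xi>. fourier (h n) \<xi> - fourier (h i) \<xi>) = norm2 lborel (\<lambda>x. h n x - h i x)" for n i
  proof -
    have "cmod (h n x - h i x) \<le> real n + real i" for x
      using norm_triangle_ineq4[of "h n x" "h i x"] hn[of n x] hn[of i x] by linarith
    moreover have "(\<lambda>\<xi>. fourier (h n) \<xi> - fourier (h i) \<xi>) = fourier (\<lambda>x. h n x - h i x)"
      using fourier_diff[OF hi hi] by auto
    ultimately show ?thesis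
      using Plancherel_bounded(2)[of "\<lambda>x. h n x - h i x" "real n + real i"] hi by simp
  qed
  note * = isometry_limit[OF f2 h2 lim Plancherel_bounded(1)[OF hi hn] _ AE_I2[OF pw]
    Plancherel_bounded(2)[OF hi hn] diff]
  show "sq_integrable lborel (fourier f)" "norm2 lborel (fourier f) = norm2 lborel f"
    using * by simp_all
qed

section \<open>The Fourier transform on \<open>L\<^sup>2\<close>\<close>

lemma L2_eq_sq_integrable: "f \<in> L2 \<longleftrightarrow> sq_integrable lebesgue f"
  by (simp add: L2_def sq_integrable_def)

lemma L2_norm_eq_norm2: "L2_norm f = norm2 lebesgue f"
  by (simp add: L2_norm_def norm2_def)

lemma sq_integrable_AE_eq:
  assumes "sq_integrable M f" "g \<in> borel_measurable M" "AE x in M. f x = g x"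
  shows "sq_integrable M g"
proof -
  have "AE x in M. (cmod (f x))\<^sup>2 = (cmod (g x))\<^sup>2" using assms(3) by eventually_elim simp
  then have "integrable M (\<lambda>x. (cmod (f x))\<^sup>2) = integrable M (\<lambda>x. (cmod (g x))\<^sup>2)"
    using assms(1,2) by (intro integrable_cong_AE) (auto simp: sq_integrable_def)
  then show ?thesis using assms(1,2) by (simp add: sq_integrable_def)
qed

lemma norm2_AE_eq:
  assumes "f \<in> borel_measurable M" "g \<in> borel_measurable M" "AE x in M. f x = g x"
  shows "norm2 M f = norm2 M g"
proof -
  have "AE x in M. (cmod (f x))\<^sup>2 = (cmod (g x))\<^sup>2" using assms(3) by eventually_elim simp
  then show ?thesis unfolding norm2_def
    using assms(1,2) by (intro arg_cong[where f = sqrt] integral_cong_AE) auto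
qed

lemma borel_imp_lebesgue_measurable:
  "f \<in> borel_measurable borel \<Longrightarrow> f \<in> borel_measurable lebesgue"
  by (rule measurable_completion) simp

lemma sq_integrable_lebesgue_iff:
  assumes [measurable]: "f \<in> borel_measurable borel"
  shows "sq_integrable lebesgue f \<longleftrightarrow> sq_integrable lborel f"
proof -
  have "integrable lebesgue (\<lambda>x. (cmod (f x))\<^sup>2) \<longleftrightarrow> integrable lborel (\<lambda>x. (cmod (f x))\<^sup>2)"
    by (rule integrable_completion) measurable
  then show ?thesis
    using borel_imp_lebesgue_measurable[OF assms] assms by (simp add: sq_integrable_def)
qed

lemma norm2_lebesgue:
  assumes [measurable]: "f \<in> borel_measurable borel"
  shows "norm2 lebesgue f = norm2 lborel f"
proof -
  have "(LINT x|lebesgue. (cmod (f x))\<^sup>2) = (LINT x|lborel. (cmod (f x))\<^sup>2)"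
    by (rule integral_completion) measurable
  then show ?thesis by (simp add: norm2_def)
qed

lemma lebesgue_ex_borel_complex:
  fixes f :: "'a::euclidean_space \<Rightarrow> complex"
  assumes "f \<in> borel_measurable lebesgue"
  obtains g where "g \<in> borel_measurable borel" "AE x in lebesgue. f x = g x"
proof -
  have "(\<lambda>x. Re (f x)) \<in> borel_measurable lebesgue" "(\<lambda>x. Im (f x)) \<in> borel_measurable lebesgue"
    using assms by measurable
  then obtain u v :: "'a \<Rightarrow> real" where uv: "u \<in> borel_measurable lborel" "v \<in> borel_measurable lborel"
    "AE x in lborel. Re (f x) = u x" "AE x in lborel. Im (f x) = v x"
    using completion_ex_borel_measurable_real by metis
  show thesis
  proof
    show "(\<lambda>x. Complex (u x) (v x)) \<in> borel_measurable borel"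
      using uv(1,2) by (simp add: Complex_eq)
    have "AE x in lborel. f x = Complex (u x) (v x)"
      using uv(3,4) by eventually_elim (simp add: complex_eq_iff)
    then show "AE x in lebesgue. f x = Complex (u x) (v x)" by (rule AE_completion)
  qed
qed

text \<open>A version of \<^const>\<open>has_L2_fourier\<close> for Borel representatives; Lebesgue measurable functions
  are not closed under the compositions that Fubini's theorem requires.\<close>

definition borel_L2_fourier :: "('a::euclidean_space \<Rightarrow> complex) \<Rightarrow> ('a \<Rightarrow> complex) \<Rightarrow> bool" where
  "borel_L2_fourier g G \<longleftrightarrow> sq_integrable lborel g \<and> sq_integrable lborel G \<and>
    (\<exists>h. (\<forall>n. integrable lborel (h n) \<and> sq_integrable lborel (h n)) \<and>
      (\<lambda>n. norm2 lborel (\<lambda>x. h n x - g x)) \<longlonglongrightarrow> 0 \<and>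
      (\<lambda>n. norm2 lborel (\<lambda>\<xi>. fourier (h n) \<xi> - G \<xi>)) \<longlonglongrightarrow> 0)"

text \<open>Each approximant \<open>h n\<close> is replaced by a Borel function equal to it almost
  everywhere. \<open>fourier\<close> does not see the change at any frequency, so both convergences
  survive.\<close>

lemma has_L2_fourier_imp_borel:
  assumes fF: "has_L2_fourier f F"
    and g[measurable]: "g \<in> borel_measurable borel" and fg: "AE x in lebesgue. f x = g x"
    and G[measurable]: "G \<in> borel_measurable borel" and FG: "AE x in lebesgue. F x = G x"
  shows "borel_L2_fourier g G"
proof -
  obtain h where h: "\<And>n. integrable lebesgue (h n)" "L2_tendsto h f" "L2_tendsto (\<lambda>n. fourier (h n)) F"
    using fF by (auto simp: has_L2_fourier_def)
  have hm: "h n \<in> borel_measurable lebesgue" for n using h(1) by auto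
  have "\<exists>k. k \<in> borel_measurable borel \<and> (AE x in lebesgue. h n x = k x)" for n
    using lebesgue_ex_borel_complex[OF hm] by metis
  then obtain k where k[measurable]: "\<And>n. k n \<in> borel_measurable borel"
    and hk: "\<And>n. AE x in lebesgue. h n x = k n x" by metis
  note leb = borel_imp_lebesgue_measurable
  have f2: "sq_integrable lebesgue f" "sq_integrable lebesgue F" "sq_integrable lebesgue (h n)"
    "sq_integrable lebesgue (fourier (h n))" for n
    using h(2,3) by (auto simp: L2_tendsto_def L2_eq_sq_integrable)
  have ki: "integrable lborel (k n)" for n
  proof -
    have "integrable lebesgue (k n)"
      using integrable_cong_AE_imp[OF h(1)[of n] leb[OF k]] hk[of n] by (simp add: eq_commute)
    then show ?thesis by (subst (asm) integrable_completion) auto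
  qed
  have fk: "fourier (h n) = fourier (k n)" for n
  proof
    fix \<xi>
    have "AE x in lebesgue. h n x * cis (- (2 * pi * (\<xi> \<bullet> x))) = k n x * cis (- (2 * pi * (\<xi> \<bullet> x)))"
      using hk[of n] by eventually_elim simp
    moreover have "(\<lambda>x::'a. cis (- (2 * pi * (\<xi> \<bullet> x)))) \<in> borel_measurable lebesgue"
      by (rule leb) measurable
    ultimately show "fourier (h n) \<xi> = fourier (k n) \<xi>"
      unfolding fourier_def using hm[of n] leb[OF k, of n]
      by (intro integral_cong_AE) auto
  qed
  have conv: "sq_integrable lborel q'" if "sq_integrable lebesgue q" "AE x in lebesgue. q x = q' x"
    "q' \<in> borel_measurable borel" for q q' :: "'a \<Rightarrow> complex"
    using sq_integrable_AE_eq[OF that(1) leb[OF that(3)] that(2)] that(3)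
    by (simp add: sq_integrable_lebesgue_iff)
  have k2: "sq_integrable lborel (k n)" for n by (rule conv[OF f2(3) hk k])
  have n1: "norm2 lebesgue (\<lambda>x. h n x - f x) = norm2 lborel (\<lambda>x. k n x - g x)" for n
  proof -
    have "norm2 lebesgue (\<lambda>x. h n x - f x) = norm2 lebesgue (\<lambda>x. k n x - g x)"
    proof (rule norm2_AE_eq)
      show "AE x in lebesgue. h n x - f x = k n x - g x"
        using hk[of n] fg by eventually_elim simp
      show "(\<lambda>x. h n x - f x) \<in> borel_measurable lebesgue"
        using f2(1) hm by (auto simp: sq_integrable_def)
      show "(\<lambda>x. k n x - g x) \<in> borel_measurable lebesgue" by (rule leb) measurable
    qed
    then show ?thesis by (simp add: norm2_lebesgue)
  qed
  have n2: "norm2 lebesgue (\<lambda>x. fourier (h n) x - F x) = norm2 lborel (\<lambda>x. fourier (k n) x - G x)" for n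
  proof -
    have "norm2 lebesgue (\<lambda>x. fourier (h n) x - F x) = norm2 lebesgue (\<lambda>x. fourier (k n) x - G x)"
    proof (rule norm2_AE_eq)
      show "AE x in lebesgue. fourier (h n) x - F x = fourier (k n) x - G x"
        unfolding fk using FG by eventually_elim simp
      show "(\<lambda>x. fourier (h n) x - F x) \<in> borel_measurable lebesgue"
        using f2(2) f2(4)[of n] by (auto simp: sq_integrable_def)
      show "(\<lambda>x. fourier (k n) x - G x) \<in> borel_measurable lebesgue" by (rule leb) measurable
    qed
    then show ?thesis by (simp add: norm2_lebesgue)
  qed
  show ?thesis
    unfolding borel_L2_fourier_def
    using h(2,3) conv[OF f2(1) fg g] conv[OF f2(2) FG G] ki k2
    by (intro conjI exI[of _ k]) (auto simp: L2_tendsto_def L2_norm_eq_norm2 n1 n2)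
qed

text \<open>Both norms are limits of the same sequence. This converts the normalisation of \<psi>2
  into one of its transform.\<close>

lemma Plancherel_L2:
  assumes "borel_L2_fourier g G"
  shows "norm2 lborel G = norm2 lborel g"
proof -
  from assms obtain h where h: "\<And>n. integrable lborel (h n)" "\<And>n. sq_integrable lborel (h n)"
    and lim: "(\<lambda>n. norm2 lborel (\<lambda>x. h n x - g x)) \<longlonglongrightarrow> 0"
      "(\<lambda>n. norm2 lborel (\<lambda>\<xi>. fourier (h n) \<xi> - G \<xi>)) \<longlonglongrightarrow> 0"
    and g: "sq_integrable lborel g" "sq_integrable lborel G"
    by (auto simp: borel_L2_fourier_def)
  from norm2_tendsto[OF g(2) Plancherel_L1_L2(1)[OF h] lim(2)] norm2_tendsto[OF g(1) h(2) lim(1)]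
  show ?thesis unfolding Plancherel_L1_L2(2)[OF h] by (rule LIMSEQ_unique)
qed

section \<open>Correlations of square integrable functions\<close>

lemma sq_integrable_translate:
  fixes g :: "'a::euclidean_space \<Rightarrow> complex"
  assumes "sq_integrable lborel g"
  shows "sq_integrable lborel (\<lambda>x. g (x - t))" "norm2 lborel (\<lambda>x. g (x - t)) = norm2 lborel g"
proof -
  have [measurable]: "g \<in> borel_measurable borel" using assms by (auto simp: sq_integrable_def)
  show "sq_integrable lborel (\<lambda>x. g (x - t))"
    using integrable_translate[of "\<lambda>x. (cmod (g x))\<^sup>2" t] assms by (auto simp: sq_integrable_def)
  show "norm2 lborel (\<lambda>x. g (x - t)) = norm2 lborel g"
    using integral_translate[of "\<lambda>x. (cmod (g x))\<^sup>2" t] by (simp add: norm2_def)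
qed

text \<open>The bound is uniform in t, so L2 convergence of an argument makes the correlations
  converge at every t; this supplies the pointwise convergence that \<open>isometry_limit\<close>
  asks for.\<close>

lemma cmod_corr_le:
  fixes f g :: "'a::euclidean_space \<Rightarrow> complex"
  assumes f: "sq_integrable lborel f" and g: "sq_integrable lborel g"
  shows "cmod (corr f g t) \<le> norm2 lborel f * norm2 lborel g"
  using Cauchy_Schwarz_integral(3)[OF f sq_integrable_translate(1)[OF g]]
  by (simp add: corr_def sq_integrable_translate(2)[OF g])

lemma corr_diff_right:
  fixes f g :: "'a::euclidean_space \<Rightarrow> complex"
  assumes f: "sq_integrable lborel f" and g: "sq_integrable lborel g" and h: "sq_integrable lborel h"
  shows "corr f (\<lambda>x. g x - h x) t = corr f g t - corr f h t"
  using Cauchy_Schwarz_integral(1)[OF f sq_integrable_translate(1)[OF g]]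
    Cauchy_Schwarz_integral(1)[OF f sq_integrable_translate(1)[OF h]]
  by (simp add: corr_def right_diff_distrib)

lemma corr_lincomb_left:
  fixes f g :: "'a::euclidean_space \<Rightarrow> complex"
  assumes f: "sq_integrable lborel f" and g: "sq_integrable lborel g" and h: "sq_integrable lborel h"
  shows "corr (\<lambda>x. f x + c * g x) h t = corr f h t + c * corr g h t"
  using Cauchy_Schwarz_integral(1)[OF f sq_integrable_translate(1)[OF h]]
    Cauchy_Schwarz_integral(1)[OF g sq_integrable_translate(1)[OF h]]
  by (simp add: corr_def distrib_right mult.assoc)

lemma sq_integrable_bounded_mult:
  assumes G: "sq_integrable M G" and b: "b \<in> borel_measurable M" and C: "\<And>x. cmod (b x) \<le> C"
  shows "sq_integrable M (\<lambda>x. b x * cnj (G x))" "norm2 M (\<lambda>x. b x * cnj (G x)) \<le> C * norm2 M G"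
proof -
  have [measurable]: "G \<in> borel_measurable M" and i: "integrable M (\<lambda>x. (cmod (G x))\<^sup>2)"
    using G by (auto simp: sq_integrable_def)
  note [measurable] = b
  have le: "(cmod (b x * cnj (G x)))\<^sup>2 \<le> C\<^sup>2 * (cmod (G x))\<^sup>2" for x
    using C[of x] by (auto simp: norm_mult power_mult_distrib intro!: mult_right_mono power_mono)
  have i2: "integrable M (\<lambda>x. (cmod (b x * cnj (G x)))\<^sup>2)"
  proof (rule Bochner_Integration.integrable_bound)
    show "integrable M (\<lambda>x. C\<^sup>2 * (cmod (G x))\<^sup>2)" using i by simp
  qed (use le in auto)
  then show "sq_integrable M (\<lambda>x. b x * cnj (G x))" by (simp add: sq_integrable_def)
  have C0: "0 \<le> C" using C norm_ge_zero order_trans by blast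
  have "(norm2 M (\<lambda>x. b x * cnj (G x)))\<^sup>2 \<le> (LINT x|M. C\<^sup>2 * (cmod (G x))\<^sup>2)"
    unfolding norm2_power2 using i i2 le by (intro integral_mono) auto
  also have "\<dots> = (C * norm2 M G)\<^sup>2" by (simp add: power_mult_distrib norm2_power2)
  finally show "norm2 M (\<lambda>x. b x * cnj (G x)) \<le> C * norm2 M G"
    by (rule power2_le_imp_le) (simp add: C0)
qed

text \<open>The correlation is integrable by Fubini and bounded by Cauchy-Schwarz, hence in L1 and
  L2, and its transform is a product.\<close>

lemma corr_Plancherel_L1_L2:
  fixes f g :: "'a::euclidean_space \<Rightarrow> complex"
  assumes f: "integrable lborel f" "sq_integrable lborel f"
    and g: "integrable lborel g" "sq_integrable lborel g"
  shows "sq_integrable lborel (corr f g)"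
    "norm2 lborel (corr f g) = norm2 lborel (\<lambda>\<xi>. fourier f \<xi> * cnj (fourier g \<xi>))"
proof -
  have i: "integrable lborel (corr f g)" by (rule integrable_corr[OF f(1) g(1)])
  show 2: "sq_integrable lborel (corr f g)"
    by (rule bounded_imp_sq_integrable[OF i cmod_corr_le[OF f(2) g(2)]])
  have "fourier (corr f g) = (\<lambda>\<xi>. fourier f \<xi> * cnj (fourier g \<xi>))"
    using fourier_corr[OF f(1) g(1)] by auto
  then show "norm2 lborel (corr f g) = norm2 lborel (\<lambda>\<xi>. fourier f \<xi> * cnj (fourier g \<xi>))"
    using Plancherel_L1_L2(2)[OF i 2] by simp
qed

text \<open>Here only the second argument is general in L2: \<open>fourier f\<close> is bounded by
  the L1 norm of \<open>f\<close>, so multiplying by it preserves the L2 convergence of the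
  transforms of the approximants.\<close>

lemma corr_Plancherel:
  fixes f g :: "'a::euclidean_space \<Rightarrow> complex"
  assumes f: "integrable lborel f" "sq_integrable lborel f" and G: "borel_L2_fourier g G"
  shows "sq_integrable lborel (corr f g)"
    "norm2 lborel (corr f g) = norm2 lborel (\<lambda>\<xi>. fourier f \<xi> * cnj (G \<xi>))"
    "sq_integrable lborel (\<lambda>\<xi>. fourier f \<xi> * cnj (G \<xi>))"
proof -
  from G obtain h where h: "\<And>n. integrable lborel (h n)" "\<And>n. sq_integrable lborel (h n)"
    and lim: "(\<lambda>n. norm2 lborel (\<lambda>x. h n x - g x)) \<longlonglongrightarrow> 0"
      "(\<lambda>n. norm2 lborel (\<lambda>\<xi>. fourier (h n) \<xi> - G \<xi>)) \<longlonglongrightarrow> 0"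
    and g: "sq_integrable lborel g" "sq_integrable lborel G"
    by (auto simp: borel_L2_fourier_def)
  have mf[measurable]: "f \<in> borel_measurable borel" using f by auto
  have mg[measurable]: "g \<in> borel_measurable borel" using g by (auto simp: sq_integrable_def)
  let ?C = "LINT x|lborel. cmod (f x)"
  note bd = sq_integrable_bounded_mult[OF _ _ cmod_fourier_le[OF f(1)]]
  have mF: "fourier f \<in> borel_measurable lborel" by simp
  note h2 = Plancherel_L1_L2(1)[OF h]
  have "(\<lambda>n. ?C * norm2 lborel (\<lambda>\<xi>. fourier (h n) \<xi> - G \<xi>)) \<longlonglongrightarrow> 0"
    using tendsto_mult[OF tendsto_const lim(2)] by simp
  then have limv: "(\<lambda>n. norm2 lborel (\<lambda>\<xi>. fourier f \<xi> * cnj (fourier (h n) \<xi>) - fourier f \<xi> * cnj (G \<xi>))) \<longlonglongrightarrow> 0"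
  proof (rule Lim_null_comparison[rotated], intro always_eventually allI)
    fix n
    show "norm (norm2 lborel (\<lambda>\<xi>. fourier f \<xi> * cnj (fourier (h n) \<xi>) - fourier f \<xi> * cnj (G \<xi>)))
      \<le> ?C * norm2 lborel (\<lambda>\<xi>. fourier (h n) \<xi> - G \<xi>)"
      using bd(2)[OF sq_integrable_diff(1)[OF h2[of n] g(2)] mF] by (simp add: right_diff_distrib)
  qed
  have pw: "AE t in lborel. (\<lambda>n. corr f (h n) t) \<longlonglongrightarrow> corr f g t"
  proof (rule AE_I2, rule LIM_zero_cancel)
    fix t
    have "(\<lambda>n. norm2 lborel f * norm2 lborel (\<lambda>x. h n x - g x)) \<longlonglongrightarrow> 0"
      using tendsto_mult[OF tendsto_const lim(1)] by simp
    then show "(\<lambda>n. corr f (h n) t - corr f g t) \<longlonglongrightarrow> 0"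
      by (rule Lim_null_comparison[rotated])
        (auto intro!: always_eventually cmod_corr_le f sq_integrable_diff h g
          simp: corr_diff_right[OF f(2) h(2) g(1), symmetric])
  qed
  have diff: "norm2 lborel (\<lambda>t. corr f (h n) t - corr f (h m) t) =
    norm2 lborel (\<lambda>\<xi>. fourier f \<xi> * cnj (fourier (h n) \<xi>) - fourier f \<xi> * cnj (fourier (h m) \<xi>))" for n m
  proof -
    have "(\<lambda>t. corr f (h n) t - corr f (h m) t) = corr f (\<lambda>x. h n x - h m x)"
      using corr_diff_right[OF f(2) h(2) h(2)] by auto
    then show ?thesis
      using corr_Plancherel_L1_L2(2)[OF f, of "\<lambda>x. h n x - h m x"] h sq_integrable_diff(1)[OF h(2,2)]
      by (simp add: fourier_diff right_diff_distrib)
  qed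
  show v: "sq_integrable lborel (\<lambda>\<xi>. fourier f \<xi> * cnj (G \<xi>))" by (rule bd(1)[OF g(2) mF])
  note * = isometry_limit[OF v bd(1)[OF h2 mF] limv corr_Plancherel_L1_L2(1)[OF f h] _ pw
    corr_Plancherel_L1_L2(2)[OF f h] diff]
  show "sq_integrable lborel (corr f g)"
    "norm2 lborel (corr f g) = norm2 lborel (\<lambda>\<xi>. fourier f \<xi> * cnj (G \<xi>))"
    using * by simp_all
qed

section \<open>Linear substitutions\<close>

lemma borel_measurable_matrix_vector_mult [measurable (raw)]:
  fixes A :: "real^'n^'m"
  shows "f \<in> borel_measurable M \<Longrightarrow> (\<lambda>x. A *v f x) \<in> borel_measurable M"
  by (rule borel_measurable_continuous_on[OF matrix_vector_mult_linear_continuous_on])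

lemma matrix_inv_mult:
  fixes A :: "real^'n^'n"
  assumes "invertible A"
  shows "A *v (matrix_inv A *v x) = x" "matrix_inv A *v (A *v x) = x"
    "det (matrix_inv A) = 1 / det A"
proof -
  have *: "A ** matrix_inv A = mat 1" "matrix_inv A ** A = mat 1"
    using assms unfolding invertible_def matrix_inv_def by (auto intro: someI2_ex)
  show "A *v (matrix_inv A *v x) = x" "matrix_inv A *v (A *v x) = x"
    using * by (simp_all add: matrix_vector_mul_assoc)
  have "det A * det (matrix_inv A) = 1"
    using * by (simp flip: det_mul)
  then show "det (matrix_inv A) = 1 / det A"
    by (metis invertible_det_nz[THEN iffD1, OF assms] nonzero_eq_divide_eq mult.commute)
qed

text \<open>It suffices to compare boxes: the preimage of a box is its image under the inverse
  matrix, whose volume is scaled by 1 / |det A|.\<close>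

lemma lborel_linear:
  fixes A :: "real^'n::{finite,wellorder}^'n::_"
  assumes A: "invertible A"
  shows "lborel = density (distr lborel borel (\<lambda>x. A *v x)) (\<lambda>_. ennreal \<bar>det A\<bar>)"
proof (rule lborel_eqI)
  let ?f = "\<lambda>x. matrix_inv A *v x"
  have det: "det A \<noteq> 0" using A by (simp add: invertible_det_nz)
  fix l u :: "(real, 'n) vec" assume le: "\<And>b. b \<in> Basis \<Longrightarrow> l \<bullet> b \<le> u \<bullet> b"
  have vim: "(\<lambda>x. A *v x) -` box l u = ?f ` box l u"
  proof (intro set_eqI iffI)
    fix x assume "x \<in> (\<lambda>x. A *v x) -` box l u"
    then show "x \<in> ?f ` box l u"
      by (intro image_eqI[of _ _ "A *v x"]) (auto simp: matrix_inv_mult[OF A])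
  qed (auto simp: matrix_inv_mult[OF A])
  have [measurable]: "?f ` box l u \<in> sets borel"
    unfolding vim[symmetric] by (rule measurable_sets_borel[of _ borel]) auto
  have lin: "linear ?f" by (rule matrix_vector_mul_linear)
  have "emeasure lborel (?f ` box l u) = emeasure lebesgue (?f ` box l u)" by simp
  also have "\<dots> = measure lebesgue (?f ` box l u)"
    by (rule emeasure_eq_measure2) (rule measurable_linear_image[OF lin], simp)
  also have "measure lebesgue (?f ` box l u) = \<bar>1 / det A\<bar> * measure lebesgue (box l u)"
    using measure_linear_image[OF lin, of "box l u"] by (simp add: matrix_inv_mult[OF A])
  finally have em: "emeasure lborel (?f ` box l u) = ennreal (\<bar>1 / det A\<bar> * measure lebesgue (box l u))" .
  have "emeasure (density (distr lborel borel (\<lambda>x. A *v x)) (\<lambda>_. ennreal \<bar>det A\<bar>)) (box l u)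
    = ennreal \<bar>det A\<bar> * emeasure lborel (?f ` box l u)"
    by (simp add: emeasure_density nn_integral_cmult emeasure_distr vim)
  also have "\<dots> = ennreal (measure lebesgue (box l u))"
    unfolding em using det by (simp flip: ennreal_mult)
  also have "\<dots> = (\<Prod>b\<in>Basis. (u - l) \<bullet> b)"
    using le by (simp add: measure_lborel_box_eq inner_diff_left)
  finally show "emeasure (density (distr lborel borel (\<lambda>x. A *v x)) (\<lambda>_. ennreal \<bar>det A\<bar>)) (box l u)
    = (\<Prod>b\<in>Basis. (u - l) \<bullet> b)" .
qed simp

lemma integral_linear_substitution:
  fixes A :: "real^'n::{finite,wellorder}^'n::_" and f :: "real^'n::_ \<Rightarrow> 'b::{banach, second_countable_topology}"
  assumes A: "invertible A" and f[measurable]: "f \<in> borel_measurable borel"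
  shows "(LINT x|lborel. f x) = \<bar>det A\<bar> *\<^sub>R (LINT x|lborel. f (A *v x))"
    "integrable lborel f \<longleftrightarrow> integrable lborel (\<lambda>x. f (A *v x))"
proof -
  have det: "det A \<noteq> 0" using A by (simp add: invertible_det_nz)
  let ?D = "density (distr lborel borel (\<lambda>x. A *v x)) (\<lambda>_. ennreal \<bar>det A\<bar>)"
  have eq: "(lborel :: (real, 'n) vec measure) = ?D" by (rule lborel_linear[OF A])
  have "integral\<^sup>L lborel f = integral\<^sup>L ?D f" using arg_cong[OF eq, of "\<lambda>M. integral\<^sup>L M f"] .
  also have "\<dots> = \<bar>det A\<bar> *\<^sub>R (LINT x|lborel. f (A *v x))"
    by (subst integral_density) (auto simp: integral_distr)
  finally show "(LINT x|lborel. f x) = \<bar>det A\<bar> *\<^sub>R (LINT x|lborel. f (A *v x))" .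
  have "integrable lborel f \<longleftrightarrow> integrable ?D f" using arg_cong[OF eq, of "\<lambda>M. integrable M f"] .
  also have "\<dots> \<longleftrightarrow> integrable lborel (\<lambda>x. f (A *v x))"
  proof -
    have "integrable lborel (\<lambda>x. f (A *v x))" if "integrable lborel (\<lambda>x. \<bar>det A\<bar> *\<^sub>R f (A *v x))"
      using integrable_scaleR_right[OF that, of "1 / \<bar>det A\<bar>"] det by simp
    then show ?thesis
      by (subst integrable_density) (auto simp: integrable_distr_eq)
  qed
  finally show "integrable lborel f \<longleftrightarrow> integrable lborel (\<lambda>x. f (A *v x))" .
qed

text \<open>The factor |det A|^(1/2) makes the substitution an isometry. It is applied in space with
  the inverse of M and in frequency with the transpose of M.\<close>

lemma sq_integrable_linear:
  fixes A :: "real^'n::{finite,wellorder}^'n::_"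
  assumes A: "invertible A" and f: "sq_integrable lborel f"
  shows "sq_integrable lborel (\<lambda>x. of_real (\<bar>det A\<bar> powr (1/2)) * f (A *v x))"
    "norm2 lborel (\<lambda>x. of_real (\<bar>det A\<bar> powr (1/2)) * f (A *v x)) = norm2 lborel f"
proof -
  have det: "det A \<noteq> 0" using A by (simp add: invertible_det_nz)
  have [measurable]: "f \<in> borel_measurable borel" using f by (auto simp: sq_integrable_def)
  have m: "(\<lambda>x. (cmod (f x))\<^sup>2) \<in> borel_measurable borel" by measurable
  have sq: "(\<bar>det A\<bar> powr (1/2))\<^sup>2 = \<bar>det A\<bar>"
    using det by (simp add: powr_half_sqrt)
  show "sq_integrable lborel (\<lambda>x. of_real (\<bar>det A\<bar> powr (1/2)) * f (A *v x))"
    by (rule sq_integrable_cmult(1))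
      (use f integral_linear_substitution(2)[OF A m] in \<open>simp add: sq_integrable_def\<close>)
  show "norm2 lborel (\<lambda>x. of_real (\<bar>det A\<bar> powr (1/2)) * f (A *v x)) = norm2 lborel f"
    unfolding norm2_def integral_linear_substitution(1)[OF A m]
    by (simp add: norm_mult power_mult_distrib sq)
qed

text \<open>Brings \<open>dilate\<close> to the form treated by \<open>sq_integrable_linear\<close>,
  with the inverse matrix in the role of \<open>A\<close>.\<close>

lemma dilate_eq:
  assumes "invertible M"
  shows "dilate M f = (\<lambda>x. of_real (\<bar>det (matrix_inv M)\<bar> powr (1/2)) * f (matrix_inv M *v x))"
  by (simp add: dilate_def[abs_def] matrix_inv_mult[OF assms] powr_minus powr_divide divide_simps)

lemma invertible_matrix_inv:
  fixes M :: "real^'n^'n"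
  assumes "invertible M" shows "invertible (matrix_inv M)"
  using assms by (simp add: invertible_det_nz matrix_inv_mult(3))

text \<open>After x = M y the phase pairs y with \<open>transpose M *v \<xi>\<close>. The
  determinant is written for the transpose so that the right side is literally a normalised
  substitution by \<open>transpose M\<close>.\<close>

lemma fourier_dilate:
  fixes M :: "real^'n::{finite,wellorder}^'n::_"
  assumes M: "invertible M" and f[measurable]: "f \<in> borel_measurable borel"
  shows "fourier (dilate M f) \<xi> = of_real (\<bar>det (transpose M)\<bar> powr (1/2)) * fourier f (transpose M *v \<xi>)"
proof -
  have det: "det M \<noteq> 0" using M by (simp add: invertible_det_nz)
  have [measurable]: "dilate M f \<in> borel_measurable borel"
    unfolding dilate_def[abs_def] by measurable
  have "fourier (dilate M f) \<xi> = \<bar>det M\<bar> *\<^sub>R (LINT y|lborel. dilate M f (M *v y) * cis (- (2 * pi * (\<xi> \<bullet> (M *v y)))))"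
    by (subst fourier_lborel, measurable) (rule integral_linear_substitution(1)[OF M], measurable)
  also have "\<dots> = \<bar>det M\<bar> *\<^sub>R (LINT y|lborel. of_real (\<bar>det M\<bar> powr (-1/2)) *
      (f y * cis (- (2 * pi * ((transpose M *v \<xi>) \<bullet> y)))))"
    by (simp add: dilate_def matrix_inv_mult[OF M] dot_lmul_matrix mult.assoc)
  also have "\<dots> = of_real (\<bar>det M\<bar> * \<bar>det M\<bar> powr (-1/2)) * fourier f (transpose M *v \<xi>)"
    by (simp add: fourier_lborel[OF f] scaleR_conv_of_real)
  also have "\<bar>det M\<bar> * \<bar>det M\<bar> powr (-1/2) = \<bar>det M\<bar> powr 1 * \<bar>det M\<bar> powr (-1/2)"
    by simp
  also have "\<dots> = \<bar>det M\<bar> powr (1/2)"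
    by (subst powr_add[symmetric]) simp
  finally show ?thesis by simp
qed

text \<open>Dilation in space and its counterpart in frequency are both isometries, so the dilated
  approximants keep their distances to the two limits.\<close>

lemma borel_L2_fourier_dilate:
  fixes M :: "real^'n::{finite,wellorder}^'n::_"
  assumes M: "invertible M" and gG: "borel_L2_fourier g G"
  shows "borel_L2_fourier (dilate M g)
    (\<lambda>\<xi>. of_real (\<bar>det (transpose M)\<bar> powr (1/2)) * G (transpose M *v \<xi>))"
proof -
  from gG obtain h where h: "\<And>n. integrable lborel (h n)" "\<And>n. sq_integrable lborel (h n)"
    and lim: "(\<lambda>n. norm2 lborel (\<lambda>x. h n x - g x)) \<longlonglongrightarrow> 0"
      "(\<lambda>n. norm2 lborel (\<lambda>\<xi>. fourier (h n) \<xi> - G \<xi>)) \<longlonglongrightarrow> 0"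
    and g: "sq_integrable lborel g" "sq_integrable lborel G"
    by (auto simp: borel_L2_fourier_def)
  have hm: "h n \<in> borel_measurable borel" for n using h(1)[of n] by auto
  note I = invertible_matrix_inv[OF M]
  have T: "invertible (transpose M)" using M by (simp add: invertible_det_nz)
  note h2 = Plancherel_L1_L2(1)[OF h]
  have 1: "sq_integrable lborel (dilate M g)" and 2: "sq_integrable lborel (dilate M (h n))" for n
    unfolding dilate_eq[OF M] by (rule sq_integrable_linear[OF I] g h)+
  have 3: "integrable lborel (dilate M (h n))" for n
    using h(1)[of n] unfolding dilate_eq[OF M]
    by (simp add: integral_linear_substitution(2)[OF I hm, of n])
  have 4: "norm2 lborel (\<lambda>x. dilate M (h n) x - dilate M g x) = norm2 lborel (\<lambda>x. h n x - g x)" for n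
    using sq_integrable_linear(2)[OF I sq_integrable_diff(1)[OF h(2)[of n] g(1)]]
    unfolding dilate_eq[OF M] by (simp add: right_diff_distrib)
  have 5: "norm2 lborel (\<lambda>\<xi>. fourier (dilate M (h n)) \<xi> - of_real (\<bar>det (transpose M)\<bar> powr (1/2)) * G (transpose M *v \<xi>))
    = norm2 lborel (\<lambda>\<xi>. fourier (h n) \<xi> - G \<xi>)" for n
    using sq_integrable_linear(2)[OF T sq_integrable_diff(1)[OF h2[of n] g(2)]]
    unfolding fourier_dilate[OF M hm] by (simp only: right_diff_distrib)
  show ?thesis
    unfolding borel_L2_fourier_def
    using 1 2 3 lim sq_integrable_linear(1)[OF T g(2)]
    by (intro conjI exI[of _ "\<lambda>n. dilate M (h n)"]) (auto simp only: 4 5)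
qed

section \<open>The shear matrices and their measure\<close>

lemma borel_measurable_vec_nth [measurable (raw)]:
  fixes f :: "'a \<Rightarrow> ('b::topological_space) ^ 'n"
  assumes "f \<in> borel_measurable M"
  shows "(\<lambda>x. f x $ i) \<in> borel_measurable M"
  by (rule borel_measurable_continuous_on[OF _ assms])
    (intro continuous_on_component continuous_on_id)

lemma borel_measurable_fst_snd [measurable]:
  "fst \<in> (borel :: ('a::second_countable_topology \<times> 'b::second_countable_topology) measure) \<rightarrow>\<^sub>M borel"
  "snd \<in> (borel :: ('a::second_countable_topology \<times> 'b::second_countable_topology) measure) \<rightarrow>\<^sub>M borel"
  by (simp_all flip: borel_prod)

lemma borel_measurable_vector_2 [measurable (raw)]:
  assumes [measurable]: "f \<in> borel_measurable M" "g \<in> borel_measurable M"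
  shows "(\<lambda>x. vector [f x, g x] :: real^2) \<in> borel_measurable M"
proof -
  have "vector [a, b] = a *\<^sub>R axis 1 1 + (b *\<^sub>R axis 2 1 :: real^2)" for a b
    by (simp add: vec_eq_iff forall_2 axis_def)
  then show ?thesis by simp
qed

section \<open>Null sets in the plane and under affine maps\<close>

lemma lborel_real_2: "(lborel :: (real^2) measure) = distr lborel borel (\<lambda>p. vector [fst p, snd p])"
proof (rule lborel_eqI)
  fix l u :: "real^2" assume le: "\<And>b. b \<in> Basis \<Longrightarrow> l \<bullet> b \<le> u \<bullet> b"
  have Basis: "(Basis :: (real^2) set) = {axis 1 1, axis 2 1}"
    by (auto simp: Basis_vec_def axis_eq_axis UNIV_2)
  have neq: "axis 1 (1::real) \<noteq> (axis 2 1 :: real^2)"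
    by (simp add: axis_eq_axis)
  have le': "l $ 1 \<le> u $ 1" "l $ 2 \<le> u $ 2"
    using le[of "axis 1 1"] le[of "axis 2 1"] by (simp_all add: Basis inner_axis)
  have "(\<lambda>p. vector [fst p, snd p]) -` box l u = box (l $ 1) (u $ 1) \<times> box (l $ 2) (u $ 2)"
    by (auto simp: mem_box Basis inner_axis)
  then have "emeasure (distr lborel borel (\<lambda>p. vector [fst p, snd p])) (box l u)
      = emeasure lborel (box (l $ 1) (u $ 1) \<times> box (l $ 2) (u $ 2))"
    by (subst emeasure_distr) (auto simp: case_prod_beta)
  also have "\<dots> = emeasure lborel (box (l $ 1) (u $ 1)) * emeasure lborel (box (l $ 2) (u $ 2))"
    by (subst lborel_prod[symmetric], rule lborel.emeasure_pair_measure_Times) auto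
  also have "\<dots> = (\<Prod>b\<in>Basis. (u - l) \<bullet> b)"
    using le' neq by (simp add: Basis inner_axis ennreal_mult)
  finally show "emeasure (distr lborel borel (\<lambda>p. vector [fst p, snd p])) (box l u)
    = (\<Prod>b\<in>Basis. (u - l) \<bullet> b)" .
qed simp

text \<open>Tonelli on pairs, carried over to \<open>real^2\<close> by \<open>lborel_real_2\<close>:
  conditions on \<xi> can be checked for fixed \<xi>1 first.\<close>

lemma AE_lborel_real_2:
  assumes P: "{x::real^2. P x} \<in> sets borel"
    and ae: "AE x in lborel. AE y in lborel. P (vector [x, y])"
  shows "AE x in lborel. P x"
proof -
  have m: "(\<lambda>p. vector [fst p, snd p] :: real^2) \<in> borel \<rightarrow>\<^sub>M borel" by measurable
  have "{p \<in> space (lborel \<Otimes>\<^sub>M lborel). P (vector [fst p, snd p])} \<in> sets (lborel \<Otimes>\<^sub>M lborel)"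
    unfolding lborel_prod using measurable_sets_borel[OF m P] by (simp add: vimage_def)
  then have "AE p in lborel \<Otimes>\<^sub>M lborel. P (vector [fst p, snd p])"
    using ae by (intro lborel_pair.AE_pair_measure) simp_all
  then have "AE p in lborel. P (vector [fst p, snd p])"
    unfolding lborel_prod .
  moreover have "{x \<in> space borel. P x} \<in> sets borel" using P by simp
  ultimately have "AE x in distr lborel borel (\<lambda>p. vector [fst p, snd p]). P x"
    by (subst AE_distr_iff) auto
  then show ?thesis unfolding lborel_real_2 .
qed

lemma AE_lborel_real_affine:
  fixes c :: real
  assumes "AE y in lborel. P y" "c \<noteq> 0"
  shows "AE x in lborel. P (t + c * x)"
proof -
  have "AE y in density (distr lborel borel (\<lambda>x. t + c * x)) (\<lambda>_. ennreal \<bar>c\<bar>). P y"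
    using assms(1) unfolding lborel_real_affine[OF assms(2), of t, symmetric] .
  then have "AE y in distr lborel borel (\<lambda>x. t + c * x). P y"
    using assms(2) by (simp add: AE_density)
  then show ?thesis by (rule AE_distrD[rotated]) simp
qed

text \<open>The matrix rescales the measure by a nonzero factor and the translation preserves it, so
  null sets pull back to null sets.\<close>

lemma AE_lborel_affine_matrix:
  fixes A :: "real^'n::{finite,wellorder}^'n::_"
  assumes "AE y in lborel. P y" and A: "invertible A"
  shows "AE x in lborel. P (A *v (x - t))"
proof -
  have det: "det A \<noteq> 0" using A by (simp add: invertible_det_nz)
  have "AE y in density (distr lborel borel (\<lambda>x. A *v x)) (\<lambda>_. ennreal \<bar>det A\<bar>). P y"
    using assms(1) unfolding lborel_linear[OF A, symmetric] .
  then have "AE y in distr lborel borel (\<lambda>x. A *v x). P y"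
    using det by (simp add: AE_density)
  then have "AE x in lborel. P (A *v x)" by (rule AE_distrD[rotated]) simp
  then have "AE x in distr lborel borel (\<lambda>x. x - t). P (A *v x)" unfolding lborel_distr_minus .
  then show ?thesis by (rule AE_distrD[rotated]) simp
qed

section \<open>Shear matrices and sigma-finiteness of their measure\<close>

lemma shear_mat_nth [simp]:
  "shear_mat a s $ 1 $ 1 = a" "shear_mat a s $ 1 $ 2 = - sqrt a * s"
  "shear_mat a s $ 2 $ 1 = 0" "shear_mat a s $ 2 $ 2 = sqrt a"
  by (simp_all add: shear_mat_def)

lemma det_shear_mat: "det (shear_mat a s) = a * sqrt a"
  by (simp add: det_2)

lemma invertible_shear_mat: "a > 0 \<Longrightarrow> invertible (shear_mat a s)"
  by (simp add: invertible_det_nz det_shear_mat)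

lemma transpose_shear_mat_mult:
  "transpose (shear_mat a s) *v \<xi> = vector [a * \<xi> $ 1, sqrt a * (\<xi> $ 2 - s * \<xi> $ 1)]"
  by (simp add: vec_eq_iff forall_2 vector_matrix_mult_def sum_2 algebra_simps)

lemma borel_measurable_shear_mat [measurable (raw)]:
  assumes "f \<in> borel_measurable M" "g \<in> borel_measurable M"
  shows "(\<lambda>x. shear_mat (f x) (g x)) \<in> borel_measurable M"
proof -
  have eq: "shear_mat (fst p) (snd p) = (\<chi> i j. if i = 1 then (if j = 1 then fst p else - sqrt (fst p) * snd p)
      else (if j = 1 then 0 else sqrt (fst p)))" for p
    by (simp add: vec_eq_iff forall_2)
  \<comment> \<open>\<open>sqrt\<close> is continuous on the whole line, so the matrix depends
    continuously on every pair (a, s), negative a included.\<close>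
  have "continuous_on UNIV (\<lambda>p. shear_mat (fst p) (snd p))"
    unfolding eq
  proof (intro continuous_on_vec_lambda)
    fix i j :: 2
    show "continuous_on UNIV (\<lambda>p. if i = 1 then (if j = 1 then fst p else - sqrt (fst p) * snd p)
      else (if j = 1 then 0 else sqrt (fst p)) :: real)"
      by (cases "i = 1"; cases "j = 1") (auto intro!: continuous_intros)
  qed
  from borel_measurable_continuous_on[OF this borel_measurable_Pair[OF assms]] show ?thesis by simp
qed

text \<open>The shear s is recovered from the upper right entry by dividing by -sqrt a. The
  description by entries makes Borel measurability evident.\<close>

lemma shear_set_eq: "shear_set = {M. M $ 1 $ 1 > 0 \<and> M $ 2 $ 1 = 0 \<and> M $ 2 $ 2 = sqrt (M $ 1 $ 1)}"
proof (intro set_eqI iffI)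
  fix M assume "M \<in> {M :: real^2^2. M $ 1 $ 1 > 0 \<and> M $ 2 $ 1 = 0 \<and> M $ 2 $ 2 = sqrt (M $ 1 $ 1)}"
  then have "M = shear_mat (M $ 1 $ 1) (- (M $ 1 $ 2) / sqrt (M $ 1 $ 1))" "M $ 1 $ 1 > 0"
    by (auto simp: vec_eq_iff forall_2)
  then show "M \<in> shear_set" unfolding shear_set_def by blast
qed (auto simp: shear_set_def)

lemma sets_shear_set [measurable]: "shear_set \<in> sets borel"
  unfolding shear_set_eq by measurable

lemma shear_mat_in_shear_set: "shear_mat a s \<in> shear_set \<longleftrightarrow> a > 0"
  by (auto simp: shear_set_eq)

lemma invertible_shear_set: "M \<in> shear_set \<Longrightarrow> invertible M"
  by (auto simp: shear_set_def invertible_shear_mat)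

text \<open>Real-valued, so that it can serve both as a density and as a scalar factor in Bochner
  integrals; it vanishes for a \<le> 0.\<close>

definition shear_weight :: "real \<times> real \<Rightarrow> real" where
  "shear_weight p = indicator {0<..} (fst p) / fst p ^ 3"

lemma borel_measurable_shear_weight [measurable]: "shear_weight \<in> borel_measurable borel"
  unfolding shear_weight_def[abs_def] by measurable

lemma shear_weight_nonneg: "0 \<le> shear_weight p"
  by (auto simp: shear_weight_def split: split_indicator)

lemma shear_measure_eq:
  "shear_measure = distr (density lborel (\<lambda>p. ennreal (shear_weight p))) borel (\<lambda>p. shear_mat (fst p) (snd p))"
  by (simp add: shear_measure_def lborel_prod shear_weight_def case_prod_beta')

lemma sets_shear_measure [simp, measurable_cong]: "sets shear_measure = sets borel"
  by (simp add: shear_measure_eq)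

lemma nn_integral_shear_measure:
  assumes [measurable]: "f \<in> borel_measurable borel"
  shows "(\<integral>\<^sup>+M. f M \<partial>shear_measure)
    = (\<integral>\<^sup>+p. ennreal (shear_weight p) * f (shear_mat (fst p) (snd p)) \<partial>lborel)"
  unfolding shear_measure_eq by (simp add: nn_integral_distr nn_integral_density)

lemma sigma_finite_shear_measure: "sigma_finite_measure shear_measure"
proof
  \<comment> \<open>Matrices with nonpositive upper left entry carry no mass because
    \<open>shear_weight\<close> vanishes there; they complete the cover. In the other piece a is
    bounded and bounded away from 0, and the entry -sqrt a s is bounded.\<close>
  define A where "A n = {M :: real^2^2. M $ 1 $ 1 \<le> 0} \<union>
    {M. 1 / real (Suc n) \<le> M $ 1 $ 1 \<and> M $ 1 $ 1 \<le> real (Suc n) \<and> \<bar>M $ 1 $ 2\<bar> \<le> real (Suc n)}" for n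
  have mA[measurable]: "A n \<in> sets borel" for n unfolding A_def by measurable
  have "emeasure shear_measure (A n) \<noteq> \<infinity>" for n
  proof -
    let ?m = "real (Suc n)"
    \<comment> \<open>From sqrt a \<ge> 1/m and |sqrt a s| \<le> m follows |s| \<le> m^2, hence the
      second side of the rectangle.\<close>
    let ?K = "cbox (1 / ?m, - (?m * ?m)) (?m, ?m * ?m)"
    have le: "ennreal (shear_weight p) * indicator (A n) (shear_mat (fst p) (snd p)) \<le> ennreal (?m ^ 3) * indicator ?K p" for p
    proof (cases "fst p > 0 \<and> shear_mat (fst p) (snd p) \<in> A n")
      case True
      then have b: "1 / ?m \<le> fst p" "fst p \<le> ?m" "\<bar>sqrt (fst p) * snd p\<bar> \<le> ?m" "fst p > 0"
        by (auto simp: A_def)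
      have "1 / ?m * \<bar>snd p\<bar> \<le> sqrt (fst p) * \<bar>snd p\<bar>"
      proof (rule mult_right_mono)
        have "(1 / ?m)\<^sup>2 \<le> 1 / ?m" using power_decreasing[of 1 2 "1 / ?m"] by simp
        then show "1 / ?m \<le> sqrt (fst p)" using b(1) by (intro real_le_rsqrt) linarith
      qed simp
      then have "1 / ?m * \<bar>snd p\<bar> \<le> ?m" using b(3,4) by (simp add: abs_mult)
      then have "\<bar>snd p\<bar> \<le> ?m * ?m" by (simp add: field_simps)
      then have "p \<in> ?K" using b by (cases p) (auto simp: cbox_Pair_eq)
      moreover have "shear_weight p \<le> ?m ^ 3"
      proof -
        have "1 / fst p \<le> ?m" using b(1,4) by (simp add: field_simps)
        then have "(1 / fst p) ^ 3 \<le> ?m ^ 3" using b(4) by (intro power_mono) auto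
        then show ?thesis using b(4) by (simp add: shear_weight_def power_divide)
      qed
      ultimately show ?thesis using True by (simp add: ennreal_leI)
    qed (auto simp: shear_weight_def split: split_indicator)
    have "emeasure shear_measure (A n) = (\<integral>\<^sup>+p. ennreal (shear_weight p) * indicator (A n) (shear_mat (fst p) (snd p)) \<partial>lborel)"
      using nn_integral_shear_measure[of "indicator (A n)"] by simp
    also have "\<dots> \<le> (\<integral>\<^sup>+p. ennreal (?m ^ 3) * indicator ?K p \<partial>lborel)"
      by (rule nn_integral_mono) (rule le)
    also have "\<dots> = ennreal (?m ^ 3) * emeasure lborel ?K" by (subst nn_integral_cmult_indicator) auto
    also have "\<dots> < \<infinity>"
      unfolding infinity_ennreal_def
      by (intro ennreal_mult_less_top[THEN iffD2] disjI2 conjI ennreal_less_top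
        emeasure_lborel_cbox_finite[unfolded infinity_ennreal_def])
    finally show ?thesis by simp
  qed
  moreover have "\<Union>(range A) = UNIV"
  proof (intro set_eqI iffI)
    fix M :: "real^2^2"
    obtain n where n: "max (max (1 / M $ 1 $ 1) (M $ 1 $ 1)) \<bar>M $ 1 $ 2\<bar> \<le> real n"
      using real_arch_simple by blast
    then have "M \<in> A n" if "M $ 1 $ 1 > 0"
      using that by (auto simp: A_def field_simps)
    moreover have "M \<in> A n" if "\<not> M $ 1 $ 1 > 0" using that by (simp add: A_def)
    ultimately show "M \<in> \<Union>(range A)" by blast
  qed auto
  ultimately show "\<exists>A. countable A \<and> A \<subseteq> sets shear_measure \<and> \<Union>A = space shear_measure \<and> (\<forall>a\<in>A. emeasure shear_measure a \<noteq> \<infinity>)"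
    by (intro exI[of _ "range A"]) (auto simp: shear_measure_eq)
qed

interpretation shear: sigma_finite_measure shear_measure
  by (rule sigma_finite_shear_measure)

interpretation lborel_shear: pair_sigma_finite lborel shear_measure ..

section \<open>Wavelet coefficients\<close>

text \<open>Cofactor formula for the inverse, visibly measurable in the matrix, whereas
  \<open>matrix_inv\<close> is defined by choice.\<close>

definition inv_mat_2 :: "real^2^2 \<Rightarrow> real^2 \<Rightarrow> real^2" where
  "inv_mat_2 M y = (1 / (M$1$1 * M$2$2 - M$1$2 * M$2$1)) *\<^sub>R
     vector [M$2$2 * y$1 - M$1$2 * y$2, M$1$1 * y$2 - M$2$1 * y$1]"

lemma inv_mat_2_eq:
  assumes "invertible M"
  shows "matrix_inv M *v y = inv_mat_2 M y"
proof -
  have det: "M$1$1 * M$2$2 - M$1$2 * M$2$1 \<noteq> 0"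
    using assms by (simp add: invertible_det_nz det_2)
  have "inv_mat_2 M (M *v z) = z" for z
  proof -
    let ?D = "M$1$1 * M$2$2 - M$1$2 * M$2$1"
    have "M$2$2 * (M$1$1 * z$1 + M$1$2 * z$2) - M$1$2 * (M$2$1 * z$1 + M$2$2 * z$2) = ?D * z$1"
      "M$1$1 * (M$2$1 * z$1 + M$2$2 * z$2) - M$2$1 * (M$1$1 * z$1 + M$1$2 * z$2) = ?D * z$2"
      by (simp_all add: algebra_simps)
    then show ?thesis
      using det by (simp add: inv_mat_2_def matrix_vector_mult_def sum_2 vec_eq_iff forall_2)
  qed
  from this[of "matrix_inv M *v y"] show ?thesis by (simp add: matrix_inv_mult[OF assms])
qed

text \<open>The indicator removes the matrices on which \<^const>\<open>matrix_inv\<close> is an arbitrary value, so that the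
  coefficients are jointly measurable.\<close>

definition wavelet_coeff :: "(real^2 \<Rightarrow> complex) \<Rightarrow> (real^2 \<Rightarrow> complex) \<Rightarrow> (real^2) \<times> (real^2^2) \<Rightarrow> complex" where
  "wavelet_coeff \<psi> f p = indicator shear_set (snd p) * corr f (dilate (snd p) \<psi>) (fst p)"

lemma borel_measurable_wavelet_coeff [measurable]:
  assumes [measurable]: "\<psi> \<in> borel_measurable borel" "f \<in> borel_measurable borel"
  shows "wavelet_coeff \<psi> f \<in> borel_measurable (lborel \<Otimes>\<^sub>M shear_measure)"
proof -
  have "wavelet_coeff \<psi> f = (\<lambda>p. indicator shear_set (snd p) *
    (LINT x|lborel. f x * cnj (complex_of_real
      (\<bar>snd p$1$1 * snd p$2$2 - snd p$1$2 * snd p$2$1\<bar> powr (- 1 / 2)) * \<psi> (inv_mat_2 (snd p) (x - fst p)))))"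
  proof
    fix p
    show "wavelet_coeff \<psi> f p = indicator shear_set (snd p) *
      (LINT x|lborel. f x * cnj (complex_of_real
        (\<bar>snd p$1$1 * snd p$2$2 - snd p$1$2 * snd p$2$1\<bar> powr (- 1 / 2)) * \<psi> (inv_mat_2 (snd p) (x - fst p))))"
    proof (cases "snd p \<in> shear_set")
      case True
      then show ?thesis
        by (simp add: wavelet_coeff_def corr_def dilate_def inv_mat_2_eq[OF invertible_shear_set] det_2)
    qed (simp add: wavelet_coeff_def)
  qed
  also have "\<dots> \<in> borel_measurable (lborel \<Otimes>\<^sub>M shear_measure)"
    unfolding inv_mat_2_def by measurable
  finally show ?thesis .
qed

text \<open>Collects what the argument uses once all functions are Borel: \<open>p1\<close> and
  \<open>p2\<close> stand for the transforms of \<psi>1 and \<psi>2, which themselves no longer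
  occur. The normalisations are nonnegative integrals, ready for Tonelli.\<close>

locale shearlet_generator =
  fixes \<psi> :: "real^2 \<Rightarrow> complex" and p1 p2 :: "real \<Rightarrow> complex"
  assumes p1 [measurable]: "p1 \<in> borel_measurable borel"
    and p2 [measurable]: "p2 \<in> borel_measurable borel"
    and fourier_\<psi>: "borel_L2_fourier \<psi> (\<lambda>\<xi>. p1 (\<xi>$1) * p2 (\<xi>$2 / \<xi>$1))"
    and calderon: "AE x in lborel. (\<integral>\<^sup>+a. indicator {0<..} a * ennreal ((cmod (p1 (a * x)))\<^sup>2 / a) \<partial>lborel) = 1"
    and p2_norm: "(\<integral>\<^sup>+y. ennreal ((cmod (p2 y))\<^sup>2) \<partial>lborel) = 1"
begin

lemma \<psi>_sq: "sq_integrable lborel \<psi>"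
  using fourier_\<psi> by (simp add: borel_L2_fourier_def)

lemma \<psi>_measurable [measurable]: "\<psi> \<in> borel_measurable borel"
  using \<psi>_sq by (simp add: sq_integrable_def)

text \<open>At a fixed matrix the coefficient is a correlation with the dilated generator, so
  \<open>corr_Plancherel\<close> applies. The factor a sqrt a is the determinant.\<close>

lemma nn_integral_coeff_t:
  assumes f: "integrable lborel f" "sq_integrable lborel f" and a: "a > 0"
  shows "(\<integral>\<^sup>+t. ennreal ((cmod (wavelet_coeff \<psi> f (t, shear_mat a s)))\<^sup>2) \<partial>lborel)
    = (\<integral>\<^sup>+\<xi>. ennreal ((cmod (fourier f \<xi>))\<^sup>2) * ennreal (a * sqrt a * ((cmod (p1 (a * \<xi>$1)))\<^sup>2 *
        (cmod (p2 (sqrt a * (\<xi>$2 - s * \<xi>$1) / (a * \<xi>$1))))\<^sup>2)) \<partial>lborel)"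
proof -
  let ?M = "shear_mat a s"
  let ?P = "\<lambda>\<xi>::real^2. of_real (\<bar>det (transpose ?M)\<bar> powr (1/2)) * (p1 (a * \<xi>$1) *
      p2 (sqrt a * (\<xi>$2 - s * \<xi>$1) / (a * \<xi>$1)))"
  have M: "invertible ?M" using a by (rule invertible_shear_mat)
  have "borel_L2_fourier (dilate ?M \<psi>) ?P"
    using borel_L2_fourier_dilate[OF M fourier_\<psi>] by (simp add: transpose_shear_mat_mult del: det_transpose transpose_matrix_vector)
  note cP = corr_Plancherel[OF f this]
  have sq: "(\<bar>det (transpose ?M)\<bar> powr (1/2))\<^sup>2 = a * sqrt a"
    using a by (simp add: det_shear_mat powr_half_sqrt)
  have "(\<integral>\<^sup>+t. ennreal ((cmod (wavelet_coeff \<psi> f (t, ?M)))\<^sup>2) \<partial>lborel)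
      = (\<integral>\<^sup>+t. ennreal ((cmod (corr f (dilate ?M \<psi>) t))\<^sup>2) \<partial>lborel)"
    using a by (simp add: wavelet_coeff_def shear_mat_in_shear_set)
  also have "\<dots> = (\<integral>\<^sup>+\<xi>. ennreal ((cmod (fourier f \<xi> * cnj (?P \<xi>)))\<^sup>2) \<partial>lborel)"
    unfolding nn_integral_norm2[OF cP(1)] nn_integral_norm2[OF cP(3)] cP(2) ..
  also have "\<dots> = (\<integral>\<^sup>+\<xi>. ennreal ((cmod (fourier f \<xi>))\<^sup>2) * ennreal (a * sqrt a * ((cmod (p1 (a * \<xi>$1)))\<^sup>2 *
        (cmod (p2 (sqrt a * (\<xi>$2 - s * \<xi>$1) / (a * \<xi>$1))))\<^sup>2)) \<partial>lborel)"
    using a by (intro nn_integral_cong)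
      (simp add: norm_mult power_mult_distrib sq ennreal_mult[symmetric] mult_ac del: det_transpose)
  finally show ?thesis .
qed

text \<open>For fixed \<xi> the s-integral is taken first, using the norm of \<open>p2\<close>; what
  remains is the Calderon integral of \<open>p1\<close> at \<xi>1.\<close>

lemma nn_integral_shear:
  assumes x: "\<xi>$1 \<noteq> 0"
    and cal: "(\<integral>\<^sup>+a. indicator {0<..} a * ennreal ((cmod (p1 (a * \<xi>$1)))\<^sup>2 / a) \<partial>lborel) = 1"
  shows "(\<integral>\<^sup>+p. ennreal (shear_weight p * (fst p * sqrt (fst p) * ((cmod (p1 (fst p * \<xi>$1)))\<^sup>2 *
        (cmod (p2 (sqrt (fst p) * (\<xi>$2 - snd p * \<xi>$1) / (fst p * \<xi>$1))))\<^sup>2))) \<partial>lborel) = 1"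
proof -
  let ?g = "\<lambda>a s. ennreal (indicator {0<..} a / a ^ 3 * (a * sqrt a * ((cmod (p1 (a * \<xi>$1)))\<^sup>2 *
        (cmod (p2 (sqrt a * (\<xi>$2 - s * \<xi>$1) / (a * \<xi>$1))))\<^sup>2)))"
  have "(\<integral>\<^sup>+p. ennreal (shear_weight p * (fst p * sqrt (fst p) * ((cmod (p1 (fst p * \<xi>$1)))\<^sup>2 *
        (cmod (p2 (sqrt (fst p) * (\<xi>$2 - snd p * \<xi>$1) / (fst p * \<xi>$1))))\<^sup>2))) \<partial>lborel)
      = (\<integral>\<^sup>+p. ?g (fst p) (snd p) \<partial>(lborel \<Otimes>\<^sub>M lborel))"
    by (simp add: lborel_prod shear_weight_def)
  also have "\<dots> = (\<integral>\<^sup>+a. \<integral>\<^sup>+s. ?g a s \<partial>lborel \<partial>lborel)"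
    by (subst lborel.nn_integral_fst[symmetric]) auto
  also have "\<dots> = (\<integral>\<^sup>+a. indicator {0<..} a * ennreal ((cmod (p1 (a * \<xi>$1)))\<^sup>2 / a) \<partial>lborel)"
  proof (rule nn_integral_cong)
    fix a :: real
    show "(\<integral>\<^sup>+s. ?g a s \<partial>lborel) = indicator {0<..} a * ennreal ((cmod (p1 (a * \<xi>$1)))\<^sup>2 / a)"
    proof (cases "a > 0")
      case False then show ?thesis by simp
    next
      case a: True
      let ?c = "- (1 / sqrt a)" and ?t = "sqrt a * \<xi>$2 / (a * \<xi>$1)"
      let ?K = "a * sqrt a / a ^ 3 * (cmod (p1 (a * \<xi>$1)))\<^sup>2"
      have sa: "sqrt a * sqrt a = a" "sqrt a > 0" using a by auto
      \<comment> \<open>Since \<xi>1 \<noteq> 0 cancels from the coefficient of s, the slope is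
        -1/sqrt a, and the affine substitution contributes sqrt a.\<close>
      have arg: "sqrt a * (\<xi>$2 - s * \<xi>$1) / (a * \<xi>$1) = ?t + ?c * s" for s
      proof -
        have "sqrt a * (\<xi>$2 - s * \<xi>$1) / (a * \<xi>$1) = ?t - (sqrt a / a) * s"
          using a x by (simp add: field_simps)
        also have "sqrt a / a = 1 / sqrt a" using sa a by (simp add: field_simps)
        finally show ?thesis by simp
      qed
      have "ennreal \<bar>?c\<bar> * (\<integral>\<^sup>+s. ennreal ((cmod (p2 (?t + ?c * s)))\<^sup>2) \<partial>lborel) = 1"
        using nn_integral_real_affine[of "\<lambda>y. ennreal ((cmod (p2 y))\<^sup>2)" ?c ?t] a p2_norm by simp
      then have "ennreal (sqrt a) * (ennreal \<bar>?c\<bar> * (\<integral>\<^sup>+s. ennreal ((cmod (p2 (?t + ?c * s)))\<^sup>2) \<partial>lborel)) = ennreal (sqrt a)"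
        by simp
      then have sub: "(\<integral>\<^sup>+s. ennreal ((cmod (p2 (?t + ?c * s)))\<^sup>2) \<partial>lborel) = ennreal (sqrt a)"
        using a by (simp add: mult.assoc[symmetric] ennreal_mult[symmetric])
      have "(\<integral>\<^sup>+s. ?g a s \<partial>lborel) = (\<integral>\<^sup>+s. ennreal ?K * ennreal ((cmod (p2 (?t + ?c * s)))\<^sup>2) \<partial>lborel)"
        unfolding arg using a by (intro nn_integral_cong) (simp add: ennreal_mult[symmetric] mult_ac)
      also have "\<dots> = ennreal ?K * ennreal (sqrt a)"
        by (subst nn_integral_cmult) (simp_all only: sub, measurable)
      also have "\<dots> = ennreal (?K * sqrt a)" using a by (intro ennreal_mult[symmetric]) auto
      \<comment> \<open>Powers of a: 3/2 from the determinant, -3 from the weight and 1/2 from the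
        s-integral add up to -1.\<close>
      also have "?K * sqrt a = (cmod (p1 (a * \<xi>$1)))\<^sup>2 / a"
      proof -
        have "?K * sqrt a = a * (sqrt a * sqrt a) / a ^ 3 * (cmod (p1 (a * \<xi>$1)))\<^sup>2" by simp
        then show ?thesis unfolding sa using a by (simp add: power3_eq_cube field_simps)
      qed
      finally show ?thesis using a by simp
    qed
  qed
  finally show ?thesis using cal by simp
qed

text \<open>The condition depends on \<xi>1 only, so the exceptional set is a null set of the line
  times the whole second axis.\<close>

lemma AE_good:
  "AE \<xi> in lborel. (\<xi>::real^2)$1 \<noteq> 0 \<and> (\<integral>\<^sup>+a. indicator {0<..} a * ennreal ((cmod (p1 (a * \<xi>$1)))\<^sup>2 / a) \<partial>lborel) = 1"
proof (rule AE_lborel_real_2)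
  show "{\<xi>::real^2. \<xi>$1 \<noteq> 0 \<and> (\<integral>\<^sup>+a. indicator {0<..} a * ennreal ((cmod (p1 (a * \<xi>$1)))\<^sup>2 / a) \<partial>lborel) = 1} \<in> sets borel"
    by measurable
  show "AE x in lborel. AE y in lborel. (vector [x, y] :: real^2)$1 \<noteq> 0 \<and>
     (\<integral>\<^sup>+a. indicator {0<..} a * ennreal ((cmod (p1 (a * (vector [x, y] :: real^2)$1)))\<^sup>2 / a) \<partial>lborel) = 1"
    using calderon AE_lborel_singleton[of "0::real"] by eventually_elim simp
qed

text \<open>The t-integral is innermost and done by Plancherel; then (a, s) and \<xi> are exchanged,
  and for almost every \<xi> the kernel integrates to 1, leaving the norm of
  \<open>fourier f\<close>.\<close>

lemma coeff_isometry_L1_L2: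
  assumes f: "integrable lborel f" "sq_integrable lborel f"
  shows "sq_integrable (lborel \<Otimes>\<^sub>M shear_measure) (wavelet_coeff \<psi> f)"
    "norm2 (lborel \<Otimes>\<^sub>M shear_measure) (wavelet_coeff \<psi> f) = norm2 lborel f"
proof -
  have [measurable]: "f \<in> borel_measurable borel" using f by auto
  let ?w = "wavelet_coeff \<psi> f"
  let ?h = "\<lambda>p (\<xi>::real^2). fst p * sqrt (fst p) * ((cmod (p1 (fst p * \<xi>$1)))\<^sup>2 *
        (cmod (p2 (sqrt (fst p) * (\<xi>$2 - snd p * \<xi>$1) / (fst p * \<xi>$1))))\<^sup>2)"
  have m: "?w \<in> borel_measurable (lborel \<Otimes>\<^sub>M shear_measure)" by measurable
  have m': "(\<lambda>(t, M). ennreal ((cmod (?w (t, M)))\<^sup>2)) \<in> borel_measurable (lborel \<Otimes>\<^sub>M shear_measure)"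
    using m by simp
  have m'': "(\<lambda>(t, M). ennreal ((cmod (?w (t, M)))\<^sup>2)) \<in> borel_measurable (lborel \<Otimes>\<^sub>M borel)"
    using m' by (simp cong: measurable_cong_sets sets_pair_measure_cong)
  have "(\<integral>\<^sup>+p. ennreal ((cmod (?w p))\<^sup>2) \<partial>(lborel \<Otimes>\<^sub>M shear_measure))
      = (\<integral>\<^sup>+M. \<integral>\<^sup>+t. ennreal ((cmod (?w (t, M)))\<^sup>2) \<partial>lborel \<partial>shear_measure)"
    using lborel_shear.nn_integral_snd[of "\<lambda>p. ennreal ((cmod (?w p))\<^sup>2)"] m by simp
  also have "\<dots> = (\<integral>\<^sup>+p. ennreal (shear_weight p) *
      (\<integral>\<^sup>+t. ennreal ((cmod (?w (t, shear_mat (fst p) (snd p))))\<^sup>2) \<partial>lborel) \<partial>lborel)"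
    by (rule nn_integral_shear_measure)
      (rule lborel.borel_measurable_nn_integral, use measurable_compose[OF measurable_pair_swap' m''] in \<open>simp add: case_prod_beta'\<close>)
  also have "\<dots> = (\<integral>\<^sup>+p. \<integral>\<^sup>+\<xi>. ennreal ((cmod (fourier f \<xi>))\<^sup>2) * ennreal (shear_weight p * ?h p \<xi>) \<partial>lborel \<partial>lborel)"
  proof (rule nn_integral_cong)
    fix p :: "real \<times> real"
    show "ennreal (shear_weight p) * (\<integral>\<^sup>+t. ennreal ((cmod (?w (t, shear_mat (fst p) (snd p))))\<^sup>2) \<partial>lborel)
      = (\<integral>\<^sup>+\<xi>. ennreal ((cmod (fourier f \<xi>))\<^sup>2) * ennreal (shear_weight p * ?h p \<xi>) \<partial>lborel)"
    proof (cases "fst p > 0")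
      case True
      have "ennreal (shear_weight p) * (\<integral>\<^sup>+t. ennreal ((cmod (?w (t, shear_mat (fst p) (snd p))))\<^sup>2) \<partial>lborel)
        = (\<integral>\<^sup>+\<xi>. ennreal (shear_weight p) * (ennreal ((cmod (fourier f \<xi>))\<^sup>2) * ennreal (?h p \<xi>)) \<partial>lborel)"
        unfolding nn_integral_coeff_t[OF f True] by (rule nn_integral_cmult[symmetric]) measurable
      also have "\<dots> = (\<integral>\<^sup>+\<xi>. ennreal ((cmod (fourier f \<xi>))\<^sup>2) * ennreal (shear_weight p * ?h p \<xi>) \<partial>lborel)"
        using True by (intro nn_integral_cong) (simp add: ennreal_mult shear_weight_nonneg mult_ac)
      finally show ?thesis .
    next
      case False then show ?thesis by (simp add: shear_weight_def)
    qed
  qed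
  also have "\<dots> = (\<integral>\<^sup>+\<xi>. \<integral>\<^sup>+p. ennreal ((cmod (fourier f \<xi>))\<^sup>2) * ennreal (shear_weight p * ?h p \<xi>) \<partial>lborel \<partial>lborel)"
    by (rule lborel_pair.Fubini') measurable
  also have "\<dots> = (\<integral>\<^sup>+\<xi>. ennreal ((cmod (fourier f \<xi>))\<^sup>2) \<partial>lborel)"
  proof (rule nn_integral_cong_AE, use AE_good in eventually_elim)
    fix \<xi> :: "real^2"
    assume "\<xi>$1 \<noteq> 0 \<and> (\<integral>\<^sup>+a. indicator {0<..} a * ennreal ((cmod (p1 (a * \<xi>$1)))\<^sup>2 / a) \<partial>lborel) = 1"
    then have "(\<integral>\<^sup>+p. ennreal (shear_weight p * ?h p \<xi>) \<partial>lborel) = 1"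
      using nn_integral_shear by blast
    moreover have "(\<lambda>p. ennreal (shear_weight p * ?h p \<xi>)) \<in> borel_measurable lborel"
      by measurable
    ultimately show "(\<integral>\<^sup>+p. ennreal ((cmod (fourier f \<xi>))\<^sup>2) * ennreal (shear_weight p * ?h p \<xi>) \<partial>lborel)
      = ennreal ((cmod (fourier f \<xi>))\<^sup>2)"
      by (simp only: nn_integral_cmult mult_1_right)
  qed
  also have "\<dots> = ennreal ((norm2 lborel f)\<^sup>2)"
    unfolding nn_integral_norm2[OF Plancherel_L1_L2(1)[OF f]] Plancherel_L1_L2(2)[OF f] ..
  finally show "sq_integrable (lborel \<Otimes>\<^sub>M shear_measure) ?w"
    "norm2 (lborel \<Otimes>\<^sub>M shear_measure) ?w = norm2 lborel f"
    using norm2_eqI_nn[OF m] by simp_all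
qed

end

context shearlet_generator
begin

lemma dilate_sq:
  assumes "M \<in> shear_set"
  shows "sq_integrable lborel (dilate M \<psi>)" "norm2 lborel (dilate M \<psi>) = norm2 lborel \<psi>"
  unfolding dilate_eq[OF invertible_shear_set[OF assms]]
  by (rule sq_integrable_linear[OF invertible_matrix_inv[OF invertible_shear_set[OF assms]] \<psi>_sq])+

lemma wavelet_coeff_lincomb:
  assumes "sq_integrable lborel f" "sq_integrable lborel g"
  shows "wavelet_coeff \<psi> (\<lambda>x. f x + c * g x) p = wavelet_coeff \<psi> f p + c * wavelet_coeff \<psi> g p"
  by (cases "snd p \<in> shear_set")
    (simp_all add: wavelet_coeff_def corr_lincomb_left[OF assms] dilate_sq)

lemma wavelet_coeff_diff:
  assumes "sq_integrable lborel f" "sq_integrable lborel g"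
  shows "wavelet_coeff \<psi> (\<lambda>x. f x - g x) p = wavelet_coeff \<psi> f p - wavelet_coeff \<psi> g p"
  using wavelet_coeff_lincomb[OF assms, of "-1"] by simp

text \<open>Uniform in the parameter (t, M), so L2 convergence of functions gives convergence of
  each coefficient.\<close>

lemma cmod_wavelet_coeff_le:
  assumes "sq_integrable lborel f"
  shows "cmod (wavelet_coeff \<psi> f p) \<le> norm2 lborel f * norm2 lborel \<psi>"
proof (cases "snd p \<in> shear_set")
  case True
  then show ?thesis
    using cmod_corr_le[OF assms dilate_sq(1)[OF True], of "fst p"]
    by (simp add: wavelet_coeff_def dilate_sq(2))
qed (simp add: wavelet_coeff_def)

text \<open>Cutting \<open>f\<close> off to balls puts it in L1 and L2; the isometry there and the
  uniform bound on coefficients feed \<open>isometry_limit\<close>.\<close>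

lemma coeff_isometry:
  assumes f: "sq_integrable lborel f"
  shows "sq_integrable (lborel \<Otimes>\<^sub>M shear_measure) (wavelet_coeff \<psi> f)"
    "norm2 (lborel \<Otimes>\<^sub>M shear_measure) (wavelet_coeff \<psi> f) = norm2 lborel f"
proof -
  have [measurable]: "f \<in> borel_measurable borel" and f2: "integrable lborel (\<lambda>x. (cmod (f x))\<^sup>2)"
    using f by (auto simp: sq_integrable_def)
  define h where "h n x = indicator (cball 0 (real n)) x * f x" for n x
  have ev: "eventually (\<lambda>n. x \<in> cball 0 (real n)) sequentially" for x :: "real^2"
    using eventually_ge_at_top[of "nat \<lceil>norm x\<rceil>"]
    by eventually_elim (simp add: nat_le_iff ceiling_le_iff)
  have cb: "cball (0::real^2) (real n) \<in> sets lborel" for n by simp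
  have h2: "sq_integrable lborel (h n)" for n
    unfolding h_def by (rule norm2_truncate(2)[OF f cb ev])
  have lim: "(\<lambda>n. norm2 lborel (\<lambda>x. h n x - f x)) \<longlonglongrightarrow> 0"
    unfolding h_def by (rule norm2_truncate(1)[OF f cb ev])
  have hi: "integrable lborel (h n)" for n
  proof (rule Bochner_Integration.integrable_bound)
    show "integrable lborel (\<lambda>x. indicator (cball 0 (real n)) x + (cmod (f x))\<^sup>2)"
      using f2 emeasure_lborel_cball_finite[of "0::real^2" "real n"]
      by (intro Bochner_Integration.integrable_add) (simp_all add: integrable_indicator_iff)
    \<comment> \<open>On the ball this bounds |f| by 1 + |f|^2; the ball has finite measure, so the
      cut-off function is integrable.\<close>
    have "r \<le> 1 + r\<^sup>2" for r :: real
      using sum_squares_bound[of r 1] zero_le_power2[of r] by (simp, linarith)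
    then show "AE x in lborel. norm (h n x) \<le> norm (indicator (cball 0 (real n)) x + (cmod (f x))\<^sup>2)"
      by (auto simp: h_def split: split_indicator)
  qed (use h2[of n] in \<open>simp add: sq_integrable_def\<close>)
  have pw: "(\<lambda>n. wavelet_coeff \<psi> (h n) p) \<longlonglongrightarrow> wavelet_coeff \<psi> f p" for p
  proof (rule LIM_zero_cancel, rule Lim_null_comparison)
    show "(\<lambda>n. norm2 lborel (\<lambda>x. h n x - f x) * norm2 lborel \<psi>) \<longlonglongrightarrow> 0"
      using tendsto_mult[OF lim tendsto_const] by simp
    show "\<forall>\<^sub>F n in sequentially. norm (wavelet_coeff \<psi> (h n) p - wavelet_coeff \<psi> f p)
        \<le> norm2 lborel (\<lambda>x. h n x - f x) * norm2 lborel \<psi>"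
      by (intro always_eventually allI)
        (simp only: wavelet_coeff_diff[OF h2 f, symmetric] cmod_wavelet_coeff_le sq_integrable_diff(1) h2 f)
  qed
  have diff: "norm2 (lborel \<Otimes>\<^sub>M shear_measure) (\<lambda>p. wavelet_coeff \<psi> (h n) p - wavelet_coeff \<psi> (h m) p)
      = norm2 lborel (\<lambda>x. h n x - h m x)" for n m
  proof -
    have "(\<lambda>p. wavelet_coeff \<psi> (h n) p - wavelet_coeff \<psi> (h m) p) = wavelet_coeff \<psi> (\<lambda>x. h n x - h m x)"
      using wavelet_coeff_diff[OF h2 h2] by auto
    then show ?thesis
      using coeff_isometry_L1_L2(2)[of "\<lambda>x. h n x - h m x"] hi sq_integrable_diff(1)[OF h2 h2] by simp
  qed
  note * = isometry_limit[OF f h2 lim coeff_isometry_L1_L2(1)[OF hi h2] _ AE_I2[OF pw]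
    coeff_isometry_L1_L2(2)[OF hi h2] diff]
  show "sq_integrable (lborel \<Otimes>\<^sub>M shear_measure) (wavelet_coeff \<psi> f)"
    "norm2 (lborel \<Otimes>\<^sub>M shear_measure) (wavelet_coeff \<psi> f) = norm2 lborel f"
    using * by simp_all
qed

text \<open>Coefficients are linear in the function, so the isometry applies to f + c g; the values
  1, -1, \<i>, -\<i> of c match the polarization identities on both sides.\<close>

lemma coeff_inner:
  assumes f: "sq_integrable lborel f" and g: "sq_integrable lborel g"
  shows "integrable (lborel \<Otimes>\<^sub>M shear_measure) (\<lambda>p. wavelet_coeff \<psi> f p * cnj (wavelet_coeff \<psi> g p))"
    "(LINT p|(lborel \<Otimes>\<^sub>M shear_measure). wavelet_coeff \<psi> f p * cnj (wavelet_coeff \<psi> g p))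
      = (LINT x|lborel. f x * cnj (g x))"
proof -
  let ?N = "lborel \<Otimes>\<^sub>M shear_measure"
  note W = coeff_isometry(1)[OF f] coeff_isometry(1)[OF g]
  show "integrable ?N (\<lambda>p. wavelet_coeff \<psi> f p * cnj (wavelet_coeff \<psi> g p))"
    by (rule Cauchy_Schwarz_integral(1)[OF W])
  have n: "norm2 ?N (\<lambda>p. wavelet_coeff \<psi> f p + c * wavelet_coeff \<psi> g p) = norm2 lborel (\<lambda>x. f x + c * g x)" for c
  proof -
    have "(\<lambda>p. wavelet_coeff \<psi> f p + c * wavelet_coeff \<psi> g p) = wavelet_coeff \<psi> (\<lambda>x. f x + c * g x)"
      using wavelet_coeff_lincomb[OF f g] by auto
    then show ?thesis
      using coeff_isometry(2)[OF sq_integrable_add(1)[OF f sq_integrable_cmult(1)[OF g]]] by simp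
  qed
  have "4 * (LINT p|?N. wavelet_coeff \<psi> f p * cnj (wavelet_coeff \<psi> g p)) = 4 * (LINT x|lborel. f x * cnj (g x))"
    unfolding integral_polarization[OF W] integral_polarization[OF f g]
    using n[of 1] n[of "-1"] n[of "\<i>"] n[of "- \<i>"] by simp
  then show "(LINT p|?N. wavelet_coeff \<psi> f p * cnj (wavelet_coeff \<psi> g p)) = (LINT x|lborel. f x * cnj (g x))"
    by simp
qed

end

section \<open>The reproducing formula\<close>

text \<open>\<open>shear_measure\<close> is built on pairs (a, s), while the triple integral runs
  over (t, s, a); this form has its coordinates in the latter order.\<close>

lemma nn_integral_shear_measure_swap:
  assumes [measurable]: "k \<in> borel_measurable borel"
  shows "(\<integral>\<^sup>+M. k M \<partial>shear_measure)
    = (\<integral>\<^sup>+q. ennreal (shear_weight (snd q, fst q)) * k (shear_mat (snd q) (fst q)) \<partial>lborel)"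
proof -
  have "(lborel :: (real \<times> real) measure) = distr lborel lborel (\<lambda>(x, y). (y, x))"
    using lborel_pair.distr_pair_swap[where 'a = real and 'b = real] unfolding lborel_prod .
  also have "\<dots> = distr lborel borel (\<lambda>q. (snd q, fst q))"
    by (rule distr_cong) auto
  finally have swap: "(lborel :: (real \<times> real) measure) = distr lborel borel (\<lambda>q. (snd q, fst q))" .
  have "(\<integral>\<^sup>+M. k M \<partial>shear_measure)
    = (\<integral>\<^sup>+p. ennreal (shear_weight p) * k (shear_mat (fst p) (snd p)) \<partial>distr lborel borel (\<lambda>q. (snd q, fst q)))"
    unfolding nn_integral_shear_measure[OF assms] swap[symmetric] ..
  then show ?thesis by (simp add: nn_integral_distr)
qed

text \<open>The density moves into the integrand, and Fubini puts the a-integral inside, as in the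
  formula to be reached.\<close>

lemma integral_shear_measure:
  fixes k :: "real^2^2 \<Rightarrow> complex"
  assumes k: "integrable shear_measure k"
  shows "(LINT M|shear_measure. k M)
    = (LINT s|lborel. LINT a|lborel. shear_weight (a, s) *\<^sub>R k (shear_mat a s))"
proof -
  have [measurable]: "k \<in> borel_measurable borel"
    using borel_measurable_integrable[OF k] by (simp cong: measurable_cong_sets)
  let ?D = "density lborel (\<lambda>p. ennreal (shear_weight p))"
  let ?k = "\<lambda>p. shear_weight p *\<^sub>R k (shear_mat (fst p) (snd p))"
  have 1: "integrable ?D (\<lambda>p. k (shear_mat (fst p) (snd p)))"
    using k unfolding shear_measure_eq by (subst (asm) integrable_distr_eq) auto
  then have i: "integrable (lborel \<Otimes>\<^sub>M lborel) ?k"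
    by (subst (asm) integrable_density) (auto simp: shear_weight_nonneg lborel_prod)
  have "(LINT M|shear_measure. k M) = (LINT p|?D. k (shear_mat (fst p) (snd p)))"
    unfolding shear_measure_eq by (rule integral_distr) auto
  also have "\<dots> = integral\<^sup>L (lborel \<Otimes>\<^sub>M lborel) ?k"
    by (subst integral_density) (auto simp: shear_weight_nonneg lborel_prod)
  also have "\<dots> = (LINT s|lborel. LINT a|lborel. ?k (a, s))"
    using lborel_pair.integral_snd[of "\<lambda>a s. ?k (a, s)"] i by (simp add: case_prod_beta')
  finally show ?thesis by simp
qed

section \<open>Passing from Lebesgue measurable functions to Borel representatives\<close>

lemma borel_measurable_lebesgue_AE:
  fixes f :: "'a::euclidean_space \<Rightarrow> 'b::topological_space"
  assumes g: "g \<in> borel_measurable borel" and fg: "AE x in lebesgue. f x = g x"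
  shows "f \<in> borel_measurable lebesgue"
proof (rule measurableI)
  fix S :: "'b set" assume "S \<in> sets borel"
  then have gS: "g -` S \<in> sets lebesgue"
    using measurable_sets_borel[OF g] by simp
  have "AE x in lebesgue. x \<in> g -` S \<longleftrightarrow> x \<in> f -` S"
    using fg by eventually_elim simp
  from completion.in_sets_AE[OF this gS] have "f -` S \<in> sets lebesgue" by simp
  then show "f -` S \<inter> space lebesgue \<in> sets lebesgue" by simp
qed simp

lemma L2_inner_AE_eq:
  assumes f: "AE x in lebesgue. f x = f' x" "f' \<in> borel_measurable borel"
    and g: "AE x in lebesgue. g x = g' x" "g' \<in> borel_measurable borel"
  shows "L2_inner f g = (LINT x|lborel. f' x * cnj (g' x))"
proof -
  have [measurable]: "f' \<in> borel_measurable borel" "g' \<in> borel_measurable borel" using f g by auto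
  have m: "(\<lambda>x. f' x * cnj (g' x)) \<in> borel_measurable borel" by measurable
  have ae: "AE x in lebesgue. f x * cnj (g x) = f' x * cnj (g' x)"
    using f(1) g(1) by eventually_elim simp
  have "L2_inner f g = (LINT x|lebesgue. f' x * cnj (g' x))"
    unfolding L2_inner_def
    by (rule integral_cong_AE[OF borel_measurable_lebesgue_AE[OF m ae] borel_imp_lebesgue_measurable[OF m] ae])
  also have "\<dots> = (LINT x|lborel. f' x * cnj (g' x))"
    by (rule integral_completion) measurable
  finally show ?thesis .
qed

lemma L2_inner_cnj: "L2_inner g f = cnj (L2_inner f g)"
  unfolding L2_inner_def by (subst Bochner_Integration.integral_cnj[symmetric]) (simp add: mult.commute)

text \<open>The affine map inside a shearlet pulls null sets back to null sets, so \<psi> may be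
  replaced by a Borel representative under every translation and dilation.\<close>

lemma L2_inner_translate_dilate:
  assumes f: "AE x in lebesgue. f x = f' x" "f' \<in> borel_measurable borel"
    and \<psi>: "AE x in lebesgue. \<psi> x = \<psi>' x" "\<psi>' \<in> borel_measurable borel"
    and M: "M \<in> shear_set"
  shows "L2_inner f (translate t (dilate M \<psi>)) = wavelet_coeff \<psi>' f' (t, M)"
proof -
  note [measurable] = f(2) \<psi>(2)
  have "AE y in lborel. \<psi> y = \<psi>' y" using \<psi>(1) by (simp add: AE_completion_iff)
  then have "AE x in lborel. \<psi> (matrix_inv M *v (x - t)) = \<psi>' (matrix_inv M *v (x - t))"
    by (rule AE_lborel_affine_matrix) (rule invertible_matrix_inv[OF invertible_shear_set[OF M]])
  then have "AE x in lborel. translate t (dilate M \<psi>) x = translate t (dilate M \<psi>') x"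
    by eventually_elim (simp add: translate_def dilate_def)
  then have ae: "AE x in lebesgue. translate t (dilate M \<psi>) x = translate t (dilate M \<psi>') x"
    by (rule AE_completion)
  have m: "translate t (dilate M \<psi>') \<in> borel_measurable borel"
    unfolding translate_def[abs_def] dilate_def by measurable
  show ?thesis
    using M unfolding L2_inner_AE_eq[OF f ae m]
    by (simp add: wavelet_coeff_def corr_def translate_def)
qed

text \<open>For x \<noteq> 0 the map a \<mapsto> a x pulls null sets back to null sets, so the
  integrands agree for almost every a.\<close>

lemma calderon_borel:
  assumes cal: "AE \<xi> in lebesgue. (\<integral>\<^sup>+a\<in>{0<..}. ennreal ((cmod (q (a * \<xi>)))\<^sup>2 / a) \<partial>lebesgue) = 1"
    and p: "AE x in lebesgue. q x = p x"
  shows "AE x in lborel. (\<integral>\<^sup>+a. indicator {0<..} a * ennreal ((cmod (p (a * x)))\<^sup>2 / a) \<partial>lborel) = 1"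
proof -
  have p': "AE x in lborel. q x = p x" using p by (simp add: AE_completion_iff)
  have "AE x in lborel. (\<integral>\<^sup>+a\<in>{0<..}. ennreal ((cmod (q (a * x)))\<^sup>2 / a) \<partial>lebesgue) = 1"
    using cal by (simp add: AE_completion_iff)
  then show ?thesis
    using AE_lborel_singleton[of "0::real"]
  proof eventually_elim
    fix x :: real
    assume x: "(\<integral>\<^sup>+a\<in>{0<..}. ennreal ((cmod (q (a * x)))\<^sup>2 / a) \<partial>lebesgue) = 1" "x \<noteq> 0"
    have "AE a in lborel. q (a * x) = p (a * x)"
      using AE_lborel_real_affine[OF p' x(2), of 0] by (simp add: mult.commute)
    then have "(\<integral>\<^sup>+a. indicator {0<..} a * ennreal ((cmod (p (a * x)))\<^sup>2 / a) \<partial>lborel)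
      = (\<integral>\<^sup>+a\<in>{0<..}. ennreal ((cmod (q (a * x)))\<^sup>2 / a) \<partial>lborel)"
      by (intro nn_integral_cong_AE) (auto simp: mult.commute)
    then show "(\<integral>\<^sup>+a. indicator {0<..} a * ennreal ((cmod (p (a * x)))\<^sup>2 / a) \<partial>lborel) = 1"
      using x(1) by (simp add: nn_integral_completion)
  qed
qed

text \<open>For fixed \<xi>1 \<noteq> 0 the ratio is a nonzero multiple of \<xi>2. The exceptional
  sets are enlarged to Borel null sets because \<open>P\<close> and \<open>Q\<close> may fail to be
  measurable, while the sectionwise test asks for a Borel set.\<close>

lemma AE_component_and_ratio:
  assumes "AE x in lborel. P x" "AE x in lborel. Q x"
  shows "AE \<xi> in lborel. (\<xi>::real^2)$1 \<noteq> 0 \<and> P (\<xi>$1) \<and> Q (\<xi>$2 / \<xi>$1)"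
proof -
  obtain N1 where N1: "\<And>x. x \<notin> N1 \<Longrightarrow> P x" "N1 \<in> null_sets lborel"
    by (rule AE_E3[OF assms(1)]) auto
  obtain N2 where N2: "\<And>x. x \<notin> N2 \<Longrightarrow> Q x" "N2 \<in> null_sets lborel"
    by (rule AE_E3[OF assms(2)]) auto
  have [measurable]: "N1 \<in> sets borel" "N2 \<in> sets borel"
    using null_setsD2[OF N1(2)] null_setsD2[OF N2(2)] by auto
  have "AE \<xi> in lborel. (\<xi>::real^2)$1 \<noteq> 0 \<and> \<xi>$1 \<notin> N1 \<and> \<xi>$2 / \<xi>$1 \<notin> N2"
  proof (rule AE_lborel_real_2)
    show "{\<xi>::real^2. \<xi>$1 \<noteq> 0 \<and> \<xi>$1 \<notin> N1 \<and> \<xi>$2 / \<xi>$1 \<notin> N2} \<in> sets borel" by measurable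
    show "AE x in lborel. AE y in lborel. (vector [x, y] :: real^2)$1 \<noteq> 0 \<and>
        (vector [x, y] :: real^2)$1 \<notin> N1 \<and> (vector [x, y] :: real^2)$2 / (vector [x, y] :: real^2)$1 \<notin> N2"
      using AE_not_in[OF N1(2)] AE_lborel_singleton[of "0::real"]
    proof eventually_elim
      fix x :: real assume x: "x \<notin> N1" "x \<noteq> 0"
      have "AE y in lborel. 0 + (1 / x) * y \<notin> N2"
        by (rule AE_lborel_real_affine[OF AE_not_in[OF N2(2)]]) (use x in simp)
      then show "AE y in lborel. (vector [x, y] :: real^2)$1 \<noteq> 0 \<and>
          (vector [x, y] :: real^2)$1 \<notin> N1 \<and> (vector [x, y] :: real^2)$2 / (vector [x, y] :: real^2)$1 \<notin> N2"
        by eventually_elim (use x in simp)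
    qed
  qed
  then show ?thesis by eventually_elim (use N1(1) N2(1) in blast)
qed

text \<open>Both conjuncts come from one integrable function of (t, M): the first reads it over
  matrices, the second over the parameters (s, a) with the density 1/a^3 written out.\<close>

theorem proposition3p1:
  fixes \<psi>1 \<psi>2 \<psi>1_hat \<psi>2_hat :: "real \<Rightarrow> complex"
    and \<psi> \<psi>_hat :: "real^2 \<Rightarrow> complex"
  assumes "\<psi>1 \<in> L2" and "\<psi>2 \<in> L2"
    and "has_L2_fourier \<psi>1 \<psi>1_hat" and "has_L2_fourier \<psi>2 \<psi>2_hat"
    and "AE \<xi> in lebesgue.
           (\<integral>\<^sup>+a\<in>{0<..}. ennreal ((cmod (\<psi>1_hat (a * \<xi>)))\<^sup>2 / a) \<partial>lebesgue) = 1"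
    and "L2_norm \<psi>2 = 1"
    and "\<psi> \<in> L2" and "has_L2_fourier \<psi> \<psi>_hat"
    and "AE \<xi> in lebesgue. \<xi>$1 \<noteq> 0 \<longrightarrow> \<psi>_hat \<xi> = \<psi>1_hat (\<xi>$1) * \<psi>2_hat (\<xi>$2 / \<xi>$1)"
  shows "continuous_wavelet shear_set shear_measure \<psi> \<and>
    (\<forall>f\<in>L2. \<forall>g\<in>L2.
       set_integrable (lborel \<Otimes>\<^sub>M (lborel \<Otimes>\<^sub>M lborel)) (UNIV \<times> (UNIV \<times> {0<..}))
         (\<lambda>(t, s, a). L2_inner f (shearlet \<psi> a s t) * L2_inner (shearlet \<psi> a s t) g
                        / complex_of_real (a ^ 3)) \<and>
       L2_inner f g =
         (LINT t|lborel. LINT s|lborel. (LINT a:{0<..}|lborel.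
            L2_inner f (shearlet \<psi> a s t) * L2_inner (shearlet \<psi> a s t) g
              / complex_of_real (a ^ 3))))"
proof -
  have m1: "\<psi>1_hat \<in> borel_measurable lebesgue" "\<psi>2_hat \<in> borel_measurable lebesgue"
    "\<psi>2 \<in> borel_measurable lebesgue" "\<psi> \<in> borel_measurable lebesgue"
    using assms by (auto simp: has_L2_fourier_def L2_tendsto_def L2_def)
  obtain p1 where p1[measurable]: "p1 \<in> borel_measurable borel" and p1_eq: "AE x in lebesgue. \<psi>1_hat x = p1 x"
    using lebesgue_ex_borel_complex[OF m1(1)] by blast
  obtain p2 where p2[measurable]: "p2 \<in> borel_measurable borel" and p2_eq: "AE x in lebesgue. \<psi>2_hat x = p2 x"
    using lebesgue_ex_borel_complex[OF m1(2)] by blast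
  obtain q2 where q2[measurable]: "q2 \<in> borel_measurable borel" and q2_eq: "AE x in lebesgue. \<psi>2 x = q2 x"
    using lebesgue_ex_borel_complex[OF m1(3)] by blast
  obtain \<psi>' where \<psi>'[measurable]: "\<psi>' \<in> borel_measurable borel" and \<psi>'_eq: "AE x in lebesgue. \<psi> x = \<psi>' x"
    using lebesgue_ex_borel_complex[OF m1(4)] by blast
  let ?P = "\<lambda>\<xi>::real^2. p1 (\<xi>$1) * p2 (\<xi>$2 / \<xi>$1)"
  \<comment> \<open>The line \<xi>1 = 0, where the quotient is 0 by convention, is a null
    set.\<close>
  have P_eq: "AE \<xi> in lebesgue. \<psi>_hat \<xi> = ?P \<xi>"
  proof -
    have "AE \<xi> in lebesgue. (\<xi>::real^2)$1 \<noteq> 0 \<and> \<psi>1_hat (\<xi>$1) = p1 (\<xi>$1) \<and>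
        \<psi>2_hat (\<xi>$2 / \<xi>$1) = p2 (\<xi>$2 / \<xi>$1)"
      using p1_eq p2_eq by (intro AE_completion AE_component_and_ratio) (simp_all add: AE_completion_iff)
    then show ?thesis using assms(9) by eventually_elim simp
  qed
  have P_meas: "?P \<in> borel_measurable borel" by measurable
  have p2_norm: "(\<integral>\<^sup>+y. ennreal ((cmod (p2 y))\<^sup>2) \<partial>lborel) = 1"
  proof -
    have b: "borel_L2_fourier q2 p2"
      by (rule has_L2_fourier_imp_borel[OF assms(4) q2 q2_eq p2 p2_eq])
    have "norm2 lborel p2 = norm2 lebesgue q2"
      using Plancherel_L2[OF b] by (simp add: norm2_lebesgue)
    also have "\<dots> = norm2 lebesgue \<psi>2" using norm2_AE_eq[OF m1(3) borel_imp_lebesgue_measurable[OF q2] q2_eq] by simp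
    also have "\<dots> = 1" using assms(6) by (simp add: L2_norm_eq_norm2)
    finally show ?thesis using b nn_integral_norm2[of lborel p2] by (simp add: borel_L2_fourier_def)
  qed
  interpret shearlet_generator \<psi>' p1 p2
    by unfold_locales (use calderon_borel[OF assms(5) p1_eq] p2_norm
      has_L2_fourier_imp_borel[OF assms(8) \<psi>' \<psi>'_eq P_meas P_eq] in simp_all)
  have main: "set_integrable (lborel \<Otimes>\<^sub>M shear_measure) (UNIV \<times> shear_set)
          (\<lambda>(t, M). L2_inner f (translate t (dilate M \<psi>)) * L2_inner (translate t (dilate M \<psi>)) g) \<and>
        L2_inner f g = (LINT t|lborel. (LINT M:shear_set|shear_measure.
             L2_inner f (translate t (dilate M \<psi>)) * L2_inner (translate t (dilate M \<psi>)) g)) \<and>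
      set_integrable (lborel \<Otimes>\<^sub>M (lborel \<Otimes>\<^sub>M lborel)) (UNIV \<times> (UNIV \<times> {0<..}))
         (\<lambda>(t, s, a). L2_inner f (shearlet \<psi> a s t) * L2_inner (shearlet \<psi> a s t) g
                        / complex_of_real (a ^ 3)) \<and>
       L2_inner f g =
         (LINT t|lborel. LINT s|lborel. (LINT a:{0<..}|lborel.
            L2_inner f (shearlet \<psi> a s t) * L2_inner (shearlet \<psi> a s t) g
              / complex_of_real (a ^ 3)))"
    if fg: "f \<in> L2" "g \<in> L2" for f g
  proof -
    have fg_m: "f \<in> borel_measurable lebesgue" "g \<in> borel_measurable lebesgue"
      using fg by (auto simp: L2_def)
    obtain f' where f'[measurable]: "f' \<in> borel_measurable borel" and f'_eq: "AE x in lebesgue. f x = f' x"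
      using lebesgue_ex_borel_complex[OF fg_m(1)] by blast
    obtain g' where g'[measurable]: "g' \<in> borel_measurable borel" and g'_eq: "AE x in lebesgue. g x = g' x"
      using lebesgue_ex_borel_complex[OF fg_m(2)] by blast
    have "sq_integrable lebesgue f'" "sq_integrable lebesgue g'"
      using sq_integrable_AE_eq[OF _ borel_imp_lebesgue_measurable[OF f'] f'_eq]
        sq_integrable_AE_eq[OF _ borel_imp_lebesgue_measurable[OF g'] g'_eq] fg
      by (simp_all add: L2_eq_sq_integrable)
    then have sq: "sq_integrable lborel f'" "sq_integrable lborel g'"
      by (simp_all add: sq_integrable_lebesgue_iff)
    \<comment> \<open>Built from the Borel representatives. Being zero off \<open>shear_set\<close>,
      it absorbs the indicators of the set integrals.\<close>
    define K where "K p = wavelet_coeff \<psi>' f' p * cnj (wavelet_coeff \<psi>' g' p)" for p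
    have H: "L2_inner f (translate t (dilate M \<psi>)) * L2_inner (translate t (dilate M \<psi>)) g = K (t, M)"
      if "M \<in> shear_set" for t M
      using L2_inner_translate_dilate[OF f'_eq f' \<psi>'_eq \<psi>' that]
        L2_inner_translate_dilate[OF g'_eq g' \<psi>'_eq \<psi>' that]
      by (simp add: K_def L2_inner_cnj[of "translate t (dilate M \<psi>)" g])
    have K0: "K (t, M) = 0" if "M \<notin> shear_set" for t M
      using that by (simp add: K_def wavelet_coeff_def)
    have HK: "indicator shear_set M *\<^sub>R (L2_inner f (translate t (dilate M \<psi>)) * L2_inner (translate t (dilate M \<psi>)) g)
        = K (t, M)" for t M
      by (cases "M \<in> shear_set") (simp_all add: H K0)
    have intK: "integrable (lborel \<Otimes>\<^sub>M shear_measure) K"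
      and fgK: "integral\<^sup>L (lborel \<Otimes>\<^sub>M shear_measure) K = L2_inner f g"
      unfolding K_def L2_inner_AE_eq[OF f'_eq f' g'_eq g']
      by (rule coeff_inner[OF sq])+
    have iter: "L2_inner f g = (LINT t|lborel. LINT M|shear_measure. K (t, M))"
      using lborel_shear.integral_fst'[OF intK] fgK by simp
    have 1: "set_integrable (lborel \<Otimes>\<^sub>M shear_measure) (UNIV \<times> shear_set)
          (\<lambda>(t, M). L2_inner f (translate t (dilate M \<psi>)) * L2_inner (translate t (dilate M \<psi>)) g)"
    proof -
      have "(\<lambda>p. indicator (UNIV \<times> shear_set) p *\<^sub>R (case p of (t, M) \<Rightarrow>
          L2_inner f (translate t (dilate M \<psi>)) * L2_inner (translate t (dilate M \<psi>)) g)) = K"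
        by (auto simp: fun_eq_iff HK indicator_times)
      then show ?thesis unfolding set_integrable_def using intK by simp
    qed
    have 2: "L2_inner f g = (LINT t|lborel. (LINT M:shear_set|shear_measure.
             L2_inner f (translate t (dilate M \<psi>)) * L2_inner (translate t (dilate M \<psi>)) g))"
      unfolding set_lebesgue_integral_def HK by (rule iter)
    have HK': "indicator {0<..} a *\<^sub>R (L2_inner f (shearlet \<psi> a s t) * L2_inner (shearlet \<psi> a s t) g / complex_of_real (a ^ 3))
        = shear_weight (a, s) *\<^sub>R K (t, shear_mat a s)" for a s t
      using H[of "shear_mat a s" t]
      by (cases "a > 0") (simp_all add: shearlet_def shear_mat_in_shear_set shear_weight_def scaleR_conv_of_real)
    have mK: "K \<in> borel_measurable (borel \<Otimes>\<^sub>M borel)"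
      using borel_measurable_integrable[OF intK] by (simp cong: measurable_cong_sets sets_pair_measure_cong)
    let ?T = "\<lambda>r :: (real^2) \<times> real \<times> real. shear_weight (snd (snd r), fst (snd r)) *\<^sub>R
        K (fst r, shear_mat (snd (snd r)) (fst (snd r)))"
    have "(\<lambda>r :: (real^2) \<times> real \<times> real. (fst r, shear_mat (snd (snd r)) (fst (snd r)))) \<in> borel \<rightarrow>\<^sub>M borel \<Otimes>\<^sub>M borel"
      by measurable
    from measurable_compose[OF this mK] have mT: "?T \<in> borel_measurable borel" by measurable
    \<comment> \<open>Absolute convergence is checked on norms: Tonelli and the passage from (s, a)
      to matrices hold for nonnegative integrals, and finiteness comes from
      \<open>intK\<close>.\<close>
    have T: "integrable (lborel \<Otimes>\<^sub>M (lborel \<Otimes>\<^sub>M lborel)) ?T"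
    proof -
      have kt: "(\<lambda>M. ennreal (norm (K (t, M)))) \<in> borel_measurable borel" for t
        using measurable_compose[OF measurable_Pair1' mK, of t] by simp
      have "(\<integral>\<^sup>+r. ennreal (norm (?T r)) \<partial>(lborel \<Otimes>\<^sub>M lborel))
          = (\<integral>\<^sup>+t. \<integral>\<^sup>+q. ennreal (norm (?T (t, q))) \<partial>lborel \<partial>lborel)"
      proof -
        have "(\<lambda>r. ennreal (norm (?T r))) \<in> borel_measurable (lborel \<Otimes>\<^sub>M lborel)"
          using measurable_compose[OF mT, of "\<lambda>z. ennreal (norm z)" borel] unfolding lborel_prod by simp
        from lborel.nn_integral_fst[OF this] show ?thesis by simp
      qed
      also have "\<dots> = (\<integral>\<^sup>+t. \<integral>\<^sup>+M. ennreal (norm (K (t, M))) \<partial>shear_measure \<partial>lborel)"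
        by (intro nn_integral_cong, subst nn_integral_shear_measure_swap[OF kt])
          (simp add: ennreal_mult shear_weight_nonneg)
      also have "\<dots> = (\<integral>\<^sup>+p. ennreal (norm (K p)) \<partial>(lborel \<Otimes>\<^sub>M shear_measure))"
        using intK by (subst shear.nn_integral_fst[symmetric]) auto
      also have "\<dots> < \<infinity>" using intK by (simp add: integrable_iff_bounded)
      finally show ?thesis using mT by (simp add: integrable_iff_bounded lborel_prod)
    qed
    have 3: "set_integrable (lborel \<Otimes>\<^sub>M (lborel \<Otimes>\<^sub>M lborel)) (UNIV \<times> (UNIV \<times> {0<..}))
         (\<lambda>(t, s, a). L2_inner f (shearlet \<psi> a s t) * L2_inner (shearlet \<psi> a s t) g / complex_of_real (a ^ 3))"
    proof -
      have "(\<lambda>p. indicator (UNIV \<times> (UNIV \<times> {0<..})) p *\<^sub>R (case p of (t, s, a) \<Rightarrow>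
          L2_inner f (shearlet \<psi> a s t) * L2_inner (shearlet \<psi> a s t) g / complex_of_real (a ^ 3))) = ?T"
        unfolding fun_eq_iff using HK' by (auto simp: indicator_times)
      then show ?thesis unfolding set_integrable_def using T by simp
    qed
    \<comment> \<open>Fubini gives integrability of M \<mapsto> K (t, M) for almost every t, so the
      inner integrals are matched almost everywhere and both outer integrands have to be shown
      measurable.\<close>
    have "(LINT t|lborel. LINT M|shear_measure. K (t, M))
        = (LINT t|lborel. LINT s|lborel. LINT a|lborel. ?T (t, s, a))"
    proof (rule integral_cong_AE)
      show "AE t in lborel. (LINT M|shear_measure. K (t, M)) = (LINT s|lborel. LINT a|lborel. ?T (t, s, a))"
        using lborel_shear.AE_integrable_fst'[OF intK]
        by eventually_elim (simp add: integral_shear_measure)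
      show "(\<lambda>t. LINT M|shear_measure. K (t, M)) \<in> borel_measurable lborel"
        using borel_measurable_integrable[OF lborel_shear.integrable_fst'[OF intK]] .
      have "(\<lambda>x. ?T (fst (fst x), snd (fst x), snd x)) \<in> borel_measurable ((lborel \<Otimes>\<^sub>M lborel) \<Otimes>\<^sub>M lborel)"
      proof -
        have "(\<lambda>x :: ((real^2) \<times> real) \<times> real. (fst (fst x), snd (fst x), snd x)) \<in> borel \<rightarrow>\<^sub>M borel"
          by (intro borel_measurable_continuous_onI continuous_intros)
        from measurable_compose[OF this mT] show ?thesis by (simp add: lborel_prod)
      qed
      then show "(\<lambda>t. LINT s|lborel. LINT a|lborel. ?T (t, s, a)) \<in> borel_measurable lborel"
        by (intro lborel.borel_measurable_lebesgue_integral) (simp add: case_prod_beta')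
    qed
    then have 4: "L2_inner f g =
         (LINT t|lborel. LINT s|lborel. (LINT a:{0<..}|lborel.
            L2_inner f (shearlet \<psi> a s t) * L2_inner (shearlet \<psi> a s t) g / complex_of_real (a ^ 3)))"
      unfolding set_lebesgue_integral_def HK' iter by simp
    show ?thesis using 1 2 3 4 by blast
  qed
  show ?thesis
    unfolding continuous_wavelet_def
    using main invertible_shear_set assms(7) by blast
qed

end
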